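(* For $n\ge2$, the following identities hold in $\mathbb Q[X,Z]$: $$\sum_{w\in B_n}(-1)^{\mathrm{neg}(w)}X^{-(\ell-\sigma-2\mathrm{maj})(w)}Z^{\mathrm{des}(w)}=\Bigl(\prod_{i=3}^n\bigl(1-X^{n^2-i^2+2i}Z\bigr)\Bigr)\Bigl((1-X^{2\binom n2}Z)(1-X^{2\binom n2+1}Z)+X^{n^2}Z(1-X^{-n})(1-X^{-n+1})\Bigr),$$ and $$\sum_{w\in B_n}(-1)^{\ell(w)}X^{-\frac12(2L-\sigma+3\mathrm{rmaj}-4n\,\mathrm{des})(w)}Z^{\mathrm{des}(w)}=\Bigl(\prod_{i=3}^n\bigl(1-X^{\binom{n+1}2-\binom{i+1}2+2i}Z\bigr)\Bigr)\Bigl((1-X^{\binom n2}Z)(1-X^{\binom n2+2}Z)+X^{\binom{n+1}2}Z(1-X^{-n+1})^2\Bigr).$$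
   Context: $B_n$ is the hyperoctahedral group of all bijections $w$ of $[\pm n]_0=\{-n,\dots,-1,0,1,\dots,n\}$ with $w(-i)=-w(i)$ for all $i$ (so $w(0)=0$). Write $w=[w(1),\dots,w(n)]$. $\ell$ is the Coxeter length with respect to the generators $s_0=[-1,2,\dots,n]$ and $s_i=[1,\dots,i-1,i+1,i,i+2,\dots,n]$, $1\le i\le n-1$. Statistics on $B_n$: $\mathrm{neg}(w)=|\{i\in\{1,\dots,n\}: w(i)<0\}|$; $L(w)=\tfrac12|\{(i,j)\in[\pm n]_0^2: i<j,\ w(i)>w(j),\ i\not\equiv j\bmod 2\}|$; $D(w)=\{i\in\{0,\dots,n-1\}: w(i)>w(i+1)\}$; $\mathrm{des}(w)=|D(w)|$; $\sigma(w)=\sum_{i\in D(w)}(n^2-i^2)$; $\mathrm{maj}(w)=\sum_{i\in D(w)}i$; $\mathrm{rmaj}(w)=\sum_{i\in D(w)}(n-i)$. A linear combination of statistics applied to $w$ means the linear combination of their values at $w$. *)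

theory Defs
  imports
    "HOL-Computational_Algebra.Polynomial_Factorial"
    "HOL-Combinatorics.Permutations"
begin

text \<open>
  An element of the hyperoctahedral group is a function on all of \<^typ>\<open>int\<close> that fixes
  every point outside \<open>{-n..n}\<close>; composition of functions is then the group multiplication.
\<close>

definition hyperoctahedral :: "nat \<Rightarrow> (int \<Rightarrow> int) set" where
  "hyperoctahedral n =
     {w. w permutes {- int n..int n} \<and> (\<forall>i\<in>{- int n..int n}. w (- i) = - w i)}"

lemma finite_hyperoctahedral: "finite (hyperoctahedral n)"
  by (rule finite_subset[OF _ finite_permutations[of "{- int n..int n}"]])
     (auto simp: hyperoctahedral_def)

definition gen :: "nat \<Rightarrow> int \<Rightarrow> int" where
  "gen i =
     (if i = 0 then transpose (- 1) 1
      else transpose (int i) (int i + 1) \<circ> transpose (- int i) (- int i - 1))"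

definition cox_length :: "nat \<Rightarrow> (int \<Rightarrow> int) \<Rightarrow> nat" where
  "cox_length n w =
     (LEAST k. \<exists>js. length js = k \<and> set js \<subseteq> {0..<n} \<and> w = foldr (\<circ>) (map gen js) id)"

definition neg :: "nat \<Rightarrow> (int \<Rightarrow> int) \<Rightarrow> nat" where
  "neg n w = card {i \<in> {1..int n}. w i < 0}"

definition odd_inversions :: "nat \<Rightarrow> (int \<Rightarrow> int) \<Rightarrow> (int \<times> int) set" where
  "odd_inversions n w =
     {(i, j) \<in> {- int n..int n} \<times> {- int n..int n}. i < j \<and> w i > w j \<and> i mod 2 \<noteq> j mod 2}"

text \<open>The division is exact on the hyperoctahedral group, see \<open>even_card_odd_inversions\<close>.\<close>

definition odd_length :: "nat \<Rightarrow> (int \<Rightarrow> int) \<Rightarrow> nat" where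
  "odd_length n w = card (odd_inversions n w) div 2"

definition Des :: "nat \<Rightarrow> (int \<Rightarrow> int) \<Rightarrow> nat set" where
  "Des n w = {i \<in> {0..<n}. w (int i) > w (int i + 1)}"

definition des :: "nat \<Rightarrow> (int \<Rightarrow> int) \<Rightarrow> nat" where
  "des n w = card (Des n w)"

definition sigma :: "nat \<Rightarrow> (int \<Rightarrow> int) \<Rightarrow> int" where
  "sigma n w = (\<Sum>i\<in>Des n w. int n ^ 2 - int i ^ 2)"

definition maj :: "nat \<Rightarrow> (int \<Rightarrow> int) \<Rightarrow> int" where
  "maj n w = (\<Sum>i\<in>Des n w. int i)"

definition rmaj :: "nat \<Rightarrow> (int \<Rightarrow> int) \<Rightarrow> int" where
  "rmaj n w = (\<Sum>i\<in>Des n w. int n - int i)"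

lemma even_card_odd_inversions:
  assumes "w \<in> hyperoctahedral n"
  shows "even (card (odd_inversions n w))"
proof -
  define A where "A = {(i, j) \<in> odd_inversions n w. i + j > 0}"
  define B where "B = {(i, j) \<in> odd_inversions n w. i + j < 0}"
  have sym: "w (- i) = - w i" if "i \<in> {- int n..int n}" for i
    using assms that by (auto simp: hyperoctahedral_def)
  have fin: "finite (odd_inversions n w)"
    by (rule finite_subset[of _ "{- int n..int n} \<times> {- int n..int n}"])
       (auto simp: odd_inversions_def)
  have "i + j \<noteq> 0" if "(i, j) \<in> odd_inversions n w" for i j
  proof
    assume "i + j = 0"
    hence "j = - i" by simp
    with that show False unfolding odd_inversions_def by auto presburger
  qed
  hence "odd_inversions n w = A \<union> B"
    unfolding A_def B_def by force
  moreover have "A \<inter> B = {}"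
    unfolding A_def B_def by auto
  moreover have "bij_betw (\<lambda>(i, j). (- j, - i)) A B"
    unfolding A_def B_def odd_inversions_def
    by (rule bij_betw_byWitness[where f' = "\<lambda>(i, j). (- j, - i)"])
       (auto simp: sym, presburger+)
  hence "card A = card B"
    by (rule bij_betw_same_card)
  moreover have "finite A" "finite B"
    using fin unfolding A_def B_def by (auto intro: finite_subset[rotated])
  ultimately show ?thesis
    by (simp add: card_Un_disjoint)
qed

lemma exponent_div_2_exact:
  "even (- (2 * int (odd_length n w) - sigma n w + 3 * rmaj n w - 4 * int n * int (des n w)))"
proof -
  have "sigma n w - 3 * rmaj n w = (\<Sum>i\<in>Des n w. (int n - int i) * (int n + int i - 3))"
    unfolding sigma_def rmaj_def sum_distrib_left sum_subtractf[symmetric]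
    by (intro sum.cong refl) (simp add: algebra_simps power2_eq_square)
  moreover have "even \<dots>"
    by (intro dvd_sum) auto
  ultimately have "even (sigma n w - 3 * rmaj n w)"
    by simp
  thus ?thesis
    by simp
qed

text \<open>
  Negative powers of \<open>X\<close> are formed in the field \<open>\<rat>(X, Z)\<close>, the fraction field of
  \<open>\<rat>[X][Z]\<close>; the polynomial ring \<open>\<rat>[X, Z]\<close> is the range of \<^const>\<open>to_fract\<close>.
\<close>

type_synonym ratfun = "rat poly poly fract"

definition X :: ratfun where
  "X = to_fract [:[:0, 1:]:]"

definition Z :: ratfun where
  "Z = to_fract [:0, 1:]"

definition polys :: "ratfun set" where
  "polys = range to_fract"

end

theory Submission
  imports Defs
begin

text \<open>
  Expanding \<open>\<Prod>i\<in>D(w). x i\<close> by inclusion-exclusion and splitting off the largest chosen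
  index \<open>b\<close> reduces the sums over \<open>B\<^sub>n\<close> to sums over \<open>B\<^sub>b\<close>, \<open>b < n\<close>, with coefficients
  the signed generating functions of the maximal parabolic quotients. For the Coxeter length this
  is the usual factorization \<open>w = u \<circ> v\<close>. The odd length is not additive along it, but a
  sign-reversing involution cancels all \<open>v\<close> that do not preserve parity, and for the remaining
  ones it is.

  Tracking the position of the value \<open>\<plusminus> n\<close> gives recursions for the quotients. With
  \<open>X = q\<close> the quotient sum for \<open>(n, b)\<close> times \<open>X ^ (- b\<^sup>2)\<close>, resp. \<open>X ^ (- b * (b + 1) / 2)\<close>, is the
  probability that a random \<open>n \<times> n\<close> matrix, resp. symmetric matrix, over the field with \<open>q\<close>
  elements has corank \<open>b\<close>. The descent weights \<open>x i\<close> are chosen so that only the expectations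
  of \<open>1\<close>, \<open>q ^ b\<close> and \<open>q ^ (2 * b)\<close> enter; these have closed forms, and the recursion over
  \<open>b\<close> then verifies the two product formulas.
\<close>

section \<open>Signed permutations\<close>

text \<open>The weights of the theorem depend on n, whereas the recursion passes to smaller groups.
  They are therefore written as \<open>c * X ^ (2 * i)\<close> times a power of
  \<open>Y = inverse X\<close>, with a free parameter \<open>c\<close>; only at the end
  \<open>c\<close> becomes \<open>X ^ (n ^ 2) * Z\<close> or its analogue with a binomial exponent.
  The second factor \<open>P\<close> of the right-hand sides is quadratic in \<open>Y ^ n\<close>,
  and the factor \<open>X ^ (2 * i)\<close> of the weights is just enough to turn it into a
  polynomial of degree 2 in \<open>X ^ b\<close>. The closed form first appears multiplied by a
  constant \<open>K\<close>, which is the product of \<open>1 - x i\<close> over i = 0, 1, 2;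
  cancelling it is why the products of the theorem start at 3. The exponents of single summands are
  not visibly nonnegative, so the equalities are proved in the fraction field and membership in
  \<open>polys\<close> is read off the right-hand sides.\<close>

lemma hyperoctahedral_iff:
  "w \<in> hyperoctahedral n \<longleftrightarrow> inj w \<and> (\<forall>i. w (- i) = - w i) \<and>
     (\<forall>i. \<bar>i\<bar> \<le> int n \<longrightarrow> \<bar>w i\<bar> \<le> int n) \<and> (\<forall>i. \<bar>i\<bar> > int n \<longrightarrow> w i = i)"
  (is "?l \<longleftrightarrow> ?r")
proof
  assume ?l
  hence p: "w permutes {- int n..int n}" and m: "\<And>i. i \<in> {- int n..int n} \<Longrightarrow> w (- i) = - w i"
    by (auto simp: hyperoctahedral_def)
  have fx: "w i = i" if "\<bar>i\<bar> > int n" for i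
    using p that by (auto simp: permutes_def abs_if split: if_splits)
  have "w (- i) = - w i" for i
    using m[of i] fx[of i] fx[of "- i"] by (cases "\<bar>i\<bar> \<le> int n") (auto simp: abs_le_iff)
  moreover have "\<bar>w i\<bar> \<le> int n" if "\<bar>i\<bar> \<le> int n" for i
    using permutes_in_image[OF p, of i] that by auto
  ultimately show ?r
    using permutes_inj[OF p] fx by blast
next
  assume r: ?r
  have "w permutes {- int n..int n}"
  proof (rule inj_imp_permutes)
    show "inj_on w {- int n..int n}"
      using r inj_on_subset by blast
    show "w i \<in> {- int n..int n}" if "i \<in> {- int n..int n}" for i
    proof -
      have "\<bar>i\<bar> \<le> int n" using that by auto
      hence "\<bar>w i\<bar> \<le> int n" using r by blast
      thus ?thesis by auto
    qed
    show "w i = i" if "i \<notin> {- int n..int n}" for i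
    proof -
      have "\<bar>i\<bar> > int n" using that by auto
      thus ?thesis using r by blast
    qed
  qed auto
  thus ?l using r by (auto simp: hyperoctahedral_def)
qed

context
  fixes w :: "int \<Rightarrow> int" and n :: nat
  assumes w: "w \<in> hyperoctahedral n"
begin

lemma hyp_minus: "w (- i) = - w i"
  and hyp_fix: "\<bar>i\<bar> > int n \<Longrightarrow> w i = i"
  and hyp_inj: "inj w"
  using w by (auto simp: hyperoctahedral_iff)

lemma hyp_eq_iff: "w i = w j \<longleftrightarrow> i = j"
  using hyp_inj by (auto simp: inj_def)

lemma hyp_0: "w 0 = 0"
  using hyp_minus[of 0] by simp

lemma hyp_eq_0_iff: "w i = 0 \<longleftrightarrow> i = 0"
  using hyp_eq_iff[of i 0] hyp_0 by simp

lemma hyp_eq_minus_iff: "w i = - w j \<longleftrightarrow> i = - j"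
  using hyp_eq_iff[of i "- j"] hyp_minus by simp

lemma hyp_bij: "bij w"
  using w permutes_bij by (auto simp: hyperoctahedral_def)

lemma hyp_abs_le_iff: "\<bar>w i\<bar> \<le> int n \<longleftrightarrow> \<bar>i\<bar> \<le> int n"
proof (cases "\<bar>i\<bar> \<le> int n")
  case True
  thus ?thesis using w by (simp add: hyperoctahedral_iff)
qed (simp add: hyp_fix)

lemma hyp_inv_f: "inv w (w i) = i"
  using hyp_inj by simp

lemma hyp_f_inv: "w (inv w i) = i"
  using hyp_bij by (simp add: bij_is_surj surj_f_inv_f)

lemma hyp_inv: "inv w \<in> hyperoctahedral n"
proof -
  have 1: "inv w (- i) = - inv w i" for i
    by (metis hyp_f_inv hyp_inv_f hyp_minus)
  have 2: "\<bar>inv w i\<bar> \<le> int n" if "\<bar>i\<bar> \<le> int n" for i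
    using hyp_abs_le_iff[of "inv w i"] that by (simp add: hyp_f_inv)
  have 3: "inv w i = i" if "\<bar>i\<bar> > int n" for i
    using hyp_inv_f[of i] hyp_fix[OF that] by simp
  have "inj (inv w)"
    using hyp_bij bij_imp_bij_inv bij_is_inj by blast
  thus ?thesis using 1 2 3 by (simp add: hyperoctahedral_iff)
qed

lemma hyp_comp:
  assumes v: "v \<in> hyperoctahedral n"
  shows "w \<circ> v \<in> hyperoctahedral n"
proof -
  have v': "inj v" "\<And>i. v (- i) = - v i" "\<And>i. \<bar>i\<bar> \<le> int n \<Longrightarrow> \<bar>v i\<bar> \<le> int n"
    "\<And>i. \<bar>i\<bar> > int n \<Longrightarrow> v i = i"
    using v unfolding hyperoctahedral_iff by blast+
  have "inj (w \<circ> v)"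
    using hyp_inj v'(1) by (rule inj_compose)
  thus ?thesis
    unfolding hyperoctahedral_iff using v'(2-4) by (simp add: hyp_minus hyp_abs_le_iff hyp_fix)
qed

lemma hyp_mono: "n \<le> m \<Longrightarrow> w \<in> hyperoctahedral m"
proof -
  assume nm: "n \<le> m"
  have "\<bar>w i\<bar> \<le> int m" if "\<bar>i\<bar> \<le> int m" for i
  proof (cases "\<bar>i\<bar> \<le> int n")
    case True
    hence "\<bar>w i\<bar> \<le> int n" by (simp add: hyp_abs_le_iff)
    thus ?thesis using nm by linarith
  next
    case False
    thus ?thesis using hyp_fix[of i] that by simp
  qed
  thus ?thesis using nm by (simp add: hyperoctahedral_iff hyp_minus hyp_inj hyp_fix)
qed

lemma hyp_restrict:
  assumes n: "n = Suc m" and top: "w (int n) = int n"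
  shows "w \<in> hyperoctahedral m"
proof -
  have "w i = i" if "\<bar>i\<bar> > int m" for i
  proof (cases "\<bar>i\<bar> > int n")
    case False
    hence "i = int n \<or> i = - int n" using that n by auto
    thus ?thesis using top hyp_minus by auto
  qed (simp add: hyp_fix)
  moreover have "\<bar>w i\<bar> \<le> int m" if "\<bar>i\<bar> \<le> int m" for i
  proof -
    have "\<bar>w i\<bar> \<le> int n" unfolding hyp_abs_le_iff using that n by simp
    moreover have "w i \<noteq> int n" using hyp_eq_iff[of i "int n"] that n top by auto
    moreover have "w i \<noteq> - int n" using hyp_eq_minus_iff[of i "int n"] that n top by auto
    ultimately show ?thesis using n by auto
  qed
  ultimately show ?thesis by (simp add: hyperoctahedral_iff hyp_minus hyp_inj)
qed

lemma Des_iff: "i \<in> Des n w \<longleftrightarrow> i < n \<and> w (int i + 1) < w (int i)"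
  by (auto simp: Des_def)

lemma not_Des: "i < n \<Longrightarrow> i \<notin> Des n w \<Longrightarrow> w (int i) < w (int i + 1)"
  using hyp_eq_iff[of "int i" "int i + 1"] by (auto simp: Des_iff)

text \<open>The relation w (-i) = - w i turns an ascent from m to m + 1 into one from -m - 1 to -m,
  so the absence of descents below b gives monotonicity on both sides of 0.\<close>

lemma hyp_strict_mono:
  assumes b: "Des n w \<inter> {..<b} = {}" "b \<le> n"
    and ij: "- int b \<le> i" "i < j" "j \<le> int b"
  shows "w i < w j"
proof -
  have step: "w k < w (k + 1)" if "- int b \<le> k" "k < int b" for k
  proof (cases "k \<ge> 0")
    case True
    then obtain m where "k = int m" using nonneg_eq_int by auto
    thus ?thesis using not_Des[of m] b that by auto
  next
    case False
    then obtain m where m: "- (k + 1) = int m" using nonneg_int_cases[of "- (k + 1)"] by auto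
    hence "w (int m) < w (int m + 1)" using not_Des[of m] b that by force
    moreover have "int m = - (k + 1)" "int m + 1 = - k" using m by auto
    ultimately have "w (- (k + 1)) < w (- k)" by metis
    thus ?thesis using hyp_minus[of k] hyp_minus[of "k + 1"] by simp
  qed
  have "w i < w (i + 1 + int d)" if "i + 1 + int d \<le> int b" for d
    using that
  proof (induction d)
    case (Suc d)
    thus ?case using step[of "i + 1 + int d"] ij by (simp add: algebra_simps)
  qed (use step ij in auto)
  from this[of "nat (j - i - 1)"] show ?thesis using ij by simp
qed

text \<open>A strictly increasing integer sequence has steps of at least 1: counting up from w 0 = 0
  bounds w k below by k, counting down from w n \<le> n bounds it above.\<close>

lemma strict_mono_imp_id:
  assumes "Des n w = {}"
  shows "w = id"
proof
  have mono: "w i < w j" if "- int n \<le> i" "i < j" "j \<le> int n" for i j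
    using hyp_strict_mono[of n i j] assms that by auto
  have ge: "w (int k) \<ge> int k" if "k \<le> n" for k
    using that
  proof (induction k)
    case 0
    show ?case using hyp_0 by simp
  next
    case (Suc k)
    thus ?case using mono[of "int k" "int (Suc k)"] by simp
  qed
  have le: "w (int n - int k) \<le> int n - int k" if "k \<le> n" for k
    using that
  proof (induction k)
    case 0
    show ?case using hyp_abs_le_iff[of "int n"] by simp
  next
    case (Suc k)
    thus ?case using mono[of "int n - int (Suc k)" "int n - int k"] by simp
  qed
  have eq: "w (int k) = int k" if "k \<le> n" for k
    using ge[OF that] le[of "n - k"] that by (simp add: of_nat_diff)
  fix i
  show "w i = id i"
  proof (cases "\<bar>i\<bar> \<le> int n")
    case True
    thus ?thesis using eq[of "nat \<bar>i\<bar>"] hyp_minus[of i] by (cases "i \<ge> 0") auto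
  qed (simp add: hyp_fix)
qed

end

lemma id_hyp [simp]: "id \<in> hyperoctahedral n"
  by (simp add: hyperoctahedral_iff)

section \<open>The simple reflections\<close>

lemma gen_0: "gen 0 i = (if \<bar>i\<bar> = 1 then - i else i)"
  by (auto simp: gen_def transpose_def)

lemma gen_pos:
  "k > 0 \<Longrightarrow> gen k i = (if i = int k then int k + 1 else if i = int k + 1 then int k
     else if i = - int k then - int k - 1 else if i = - int k - 1 then - int k else i)"
  by (auto simp: gen_def transpose_def)

lemma gen_gen [simp]: "gen k (gen k i) = i"
  by (cases "k = 0") (auto simp: gen_0 gen_pos)

lemma gen_hyp:
  assumes "k < n"
  shows "gen k \<in> hyperoctahedral n"
proof -
  have "inj (gen k)" by (rule inj_on_inverseI[of _ "gen k"]) simp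
  thus ?thesis using assms
    by (cases "k = 0") (auto simp: hyperoctahedral_iff gen_0 gen_pos)
qed

text \<open>\<open>gen k\<close> exchanges neighbouring values (for k = 0, the values -1 and 1
  around 0) together with their mirror images, so only comparisons among these values can
  change.\<close>

lemma gen_less_iff:
  assumes "\<not> (\<bar>a\<bar> \<in> {int k, int k + 1} \<and> \<bar>b\<bar> \<in> {int k, int k + 1})"
  shows "gen k a < gen k b \<longleftrightarrow> a < b"
proof (cases "k = 0")
  case True
  thus ?thesis using assms by (auto simp: gen_0)
next
  case False
  have less: "gen k x < gen k y" if "x < y"
    "\<not> (\<bar>x\<bar> \<in> {int k, int k + 1} \<and> \<bar>y\<bar> \<in> {int k, int k + 1})" for x y
  proof (cases "\<bar>x\<bar> \<in> {int k, int k + 1}")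
    case True
    hence "\<bar>y\<bar> \<notin> {int k, int k + 1}" using that by blast
    hence "gen k y = y" using False by (auto simp: gen_pos)
    moreover have "y < - int k - 1 \<or> - int k < y \<and> y < int k \<or> y > int k + 1"
      using \<open>\<bar>y\<bar> \<notin> _\<close> by auto
    moreover have "x \<in> {int k, int k + 1, - int k, - int k - 1}" using True by auto
    ultimately show ?thesis using \<open>x < y\<close> False by (auto simp: gen_pos)
  next
    case x: False
    hence "gen k x = x" using False by (auto simp: gen_pos)
    moreover have "x < - int k - 1 \<or> - int k < x \<and> x < int k \<or> x > int k + 1"
      using x by auto
    ultimately show ?thesis using \<open>x < y\<close> gen_pos[of k y] False by (auto split: if_splits)
  qed
  show ?thesis
    using less[of a b] less[of b a] assms by (metis less_asym linorder_less_linear)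
qed

section \<open>Inversions and the Coxeter length\<close>

text \<open>
  An inversion of a signed permutation is recorded by the one of the two mirror pairs \<open>(i, j)\<close>,
  \<open>(- j, - i)\<close> with \<open>i + j > 0\<close>.
\<close>

definition inversions :: "(int \<Rightarrow> int \<Rightarrow> bool) \<Rightarrow> nat \<Rightarrow> (int \<Rightarrow> int) \<Rightarrow> (int \<times> int) set" where
  "inversions R n w = {(i, j). \<bar>i\<bar> < j \<and> j \<le> int n \<and> R i j \<and> w j < w i}"

lemma finite_inversions [simp]: "finite (inversions R n w)"
  by (rule finite_subset[of _ "{- int n..int n} \<times> {- int n..int n}"])
     (auto simp: inversions_def)

text \<open>The number of positive roots of type B that \<open>w\<close> makes negative: pairs with
  i > 0 and i < 0 belong to the roots e_j - e_i and e_j + e_i, and \<open>neg\<close> counts the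
  e_j. A pair (0, j) would be an inversion exactly when w j < 0, hence the exclusion of i =
  0.\<close>

definition signed_length :: "nat \<Rightarrow> (int \<Rightarrow> int) \<Rightarrow> nat" where
  "signed_length n w = card (inversions (\<lambda>i j. i \<noteq> 0) n w) + neg n w"

lemma comp_gen_gen: "w \<circ> gen k \<circ> gen k = w"
  by (simp add: fun_eq_iff)

text \<open>For nonzero i, |i| < j forces j > 1, so the sign change at position 1 merely swaps the
  pairs (1, j) and (-1, j).\<close>

lemma inversions_gen_0:
  "card (inversions (\<lambda>i j. i \<noteq> 0) n (w \<circ> gen 0)) = card (inversions (\<lambda>i j. i \<noteq> 0) n w)"
proof -
  have "bij_betw (\<lambda>(i, j). (gen 0 i, j)) (inversions (\<lambda>i j. i \<noteq> 0) n w)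
          (inversions (\<lambda>i j. i \<noteq> 0) n (w \<circ> gen 0))"
    by (rule bij_betw_byWitness[where f' = "\<lambda>(i, j). (gen 0 i, j)"])
       (auto simp: inversions_def gen_0 split: if_splits)
  from bij_betw_same_card[OF this] show ?thesis by simp
qed

lemma inversions_gen_pos:
  assumes w: "w \<in> hyperoctahedral n" and k: "0 < k" "k < n" "w (int k) < w (int k + 1)"
  shows "card (inversions (\<lambda>i j. i \<noteq> 0) n (w \<circ> gen k)) =
    Suc (card (inversions (\<lambda>i j. i \<noteq> 0) n w))"
proof -
  let ?p = "(int k, int k + 1)" and ?q = "(- int k, int k + 1)"
  \<comment> \<open>\<open>gen k\<close> sends \<open>?q\<close> to (-k - 1, k), the mirror image of
    \<open>?q\<close>, which is not a recorded pair; so \<open>f\<close> keeps \<open>?q\<close>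
    fixed. Its status depends only on the sign of w k + w (k + 1) and does not change. The pair
    \<open>?p\<close> is the one new inversion.\<close>
  define f where "f = (\<lambda>(i, j). if (i, j) = ?q then ?q else (gen k i, gen k j))"
  define I where "I = inversions (\<lambda>i j. i \<noteq> 0) n"
  have pair: "\<bar>gen k i\<bar> < gen k j \<and> gen k j \<le> int n \<and> gen k i \<noteq> 0 \<and> (gen k i, gen k j) \<noteq> ?p
      \<and> (gen k i, gen k j) \<noteq> ?q"
    if "\<bar>i\<bar> < j" "j \<le> int n" "i \<noteq> 0" "(i, j) \<noteq> ?p" "(i, j) \<noteq> ?q" for i j
  proof -
    consider "j = int k" | "j = int k + 1" | "j < int k" | "j > int k + 1" by linarith
    thus ?thesis
    proof cases
      case 2
      thus ?thesis using that k by (auto simp: gen_pos)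
    next
      case 4
      thus ?thesis using that k by (auto simp: gen_pos)
    next
      case 1
      thus ?thesis using that k by (auto simp: gen_pos)
    next
      case 3
      thus ?thesis using that k by (auto simp: gen_pos)
    qed
  qed
  have q: "?q \<in> I w \<longleftrightarrow> ?q \<in> I (w \<circ> gen k)"
    using k hyp_minus[OF w, of "int k"] hyp_minus[OF w, of "int k + 1"]
    by (auto simp: I_def inversions_def gen_pos)
  have p: "?p \<notin> I w" "?p \<in> I (w \<circ> gen k)"
    using k by (auto simp: I_def inversions_def gen_pos)
  have ff: "f (f x) = x" if "x \<in> I v - {?p}" for x v
  proof (cases "x = ?q")
    case True
    thus ?thesis by (simp add: f_def)
  next
    case False
    obtain i j where x: "x = (i, j)" by (cases x)
    have "(gen k i, gen k j) \<noteq> ?q"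
      using pair[of i j] that False unfolding x by (auto simp: I_def inversions_def)
    thus ?thesis using False unfolding x f_def by auto
  qed
  have fI: "f ` (I v - {?p}) \<subseteq> I (v \<circ> gen k) - {?p}"
    if v: "?q \<in> I v \<longleftrightarrow> ?q \<in> I (v \<circ> gen k)" for v
  proof
    fix y assume "y \<in> f ` (I v - {?p})"
    then obtain i j where y: "y = f (i, j)" and ij: "(i, j) \<in> I v" "(i, j) \<noteq> ?p" by auto
    show "y \<in> I (v \<circ> gen k) - {?p}"
    proof (cases "(i, j) = ?q")
      case True
      thus ?thesis using y ij v k by (auto simp: f_def)
    next
      case False
      have "y = (gen k i, gen k j)" using False y by (auto simp: f_def)
      thus ?thesis using pair[of i j] ij False by (auto simp: I_def inversions_def)
    qed
  qed
  have "bij_betw f (I w - {?p}) (I (w \<circ> gen k) - {?p})"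
    using fI[of w] fI[of "w \<circ> gen k"] q ff unfolding comp_gen_gen by (intro bij_betw_byWitness[where f' = f]) auto
  hence "card (I w) = card (I (w \<circ> gen k) - {?p})"
    using p bij_betw_same_card by fastforce
  also have "Suc \<dots> = card (I (w \<circ> gen k))"
    using p by (intro card_Suc_Diff1) (auto simp: I_def)
  finally show ?thesis unfolding I_def by (rule sym)
qed

lemma neg_gen_pos:
  assumes "0 < k" "k < n"
  shows "neg n (w \<circ> gen k) = neg n w"
proof -
  have "bij_betw (gen k) {i \<in> {1..int n}. w i < 0} {i \<in> {1..int n}. (w \<circ> gen k) i < 0}"
    by (rule bij_betw_byWitness[where f' = "gen k"]) (use assms in \<open>auto simp: gen_pos\<close>)
  from bij_betw_same_card[OF this] show ?thesis by (simp add: neg_def)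
qed

lemma neg_gen_0:
  assumes w: "w \<in> hyperoctahedral n" and "0 < n" "0 < w 1"
  shows "neg n (w \<circ> gen 0) = Suc (neg n w)"
proof -
  have "{i \<in> {1..int n}. (w \<circ> gen 0) i < 0} = insert 1 {i \<in> {1..int n}. w i < 0}"
    using assms hyp_minus[OF w, of 1] by (auto simp: gen_0)
  moreover have "1 \<notin> {i \<in> {1..int n}. w i < 0}" using assms by simp
  moreover have "finite {i \<in> {1..int n}. w i < 0}" by (rule finite_Collect_conjI) simp
  ultimately show ?thesis
    unfolding neg_def by simp
qed

lemma signed_length_gen:
  assumes w: "w \<in> hyperoctahedral n" and k: "k < n" "w (int k) < w (int k + 1)"
  shows "signed_length n (w \<circ> gen k) = Suc (signed_length n w)"
proof (cases "k = 0")
  case True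
  thus ?thesis using neg_gen_0[OF w] k hyp_0[OF w]
    by (simp add: signed_length_def inversions_gen_0)
next
  case False
  thus ?thesis using neg_gen_pos[of k n w] inversions_gen_pos[OF w, of k] k
    by (simp add: signed_length_def)
qed

lemma signed_length_gen_Des:
  assumes w: "w \<in> hyperoctahedral n" and k: "k \<in> Des n w"
  shows "signed_length n w = Suc (signed_length n (w \<circ> gen k))"
proof -
  have k': "k < n" "w (int k + 1) < w (int k)"
    using k by (auto simp: Des_iff[OF w])
  have mem: "w \<circ> gen k \<in> hyperoctahedral n"
    by (intro hyp_comp w gen_hyp k')
  have "(w \<circ> gen k) (int k) < (w \<circ> gen k) (int k + 1)"
    using k' hyp_minus[OF w, of 1] hyp_0[OF w]
    by (cases "k = 0") (auto simp: gen_0 gen_pos)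
  from signed_length_gen[OF mem k'(1) this] show ?thesis
    unfolding comp_gen_gen .
qed

lemma signed_length_id [simp]: "signed_length n id = 0"
proof -
  have "inversions (\<lambda>i j. i \<noteq> 0) n id = {}" "{i \<in> {1..int n}. id i < 0} = {}"
    by (auto simp: inversions_def)
  thus ?thesis unfolding signed_length_def neg_def by (simp only: card.empty)
qed

definition gen_word :: "nat list \<Rightarrow> int \<Rightarrow> int" where
  "gen_word js = foldr (\<circ>) (map gen js) id"

lemma gen_word_simps [simp]: "gen_word [] = id" "gen_word (k # js) = gen k \<circ> gen_word js"
  by (simp_all add: gen_word_def)

lemma gen_word_snoc: "gen_word (js @ [k]) = gen_word js \<circ> gen k"
  by (induction js) (auto simp: comp_assoc)

text \<open>Each letter changes the length by exactly one. This bounds the length of every word from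
  below and shows that all words for an element have the same parity.\<close>

lemma gen_word_length:
  assumes "set js \<subseteq> {0..<n}"
  shows "gen_word js \<in> hyperoctahedral n \<and> signed_length n (gen_word js) \<le> length js \<and>
    even (signed_length n (gen_word js) + length js)"
  using assms
proof (induction js rule: rev_induct)
  case (snoc k js)
  let ?w = "gen_word js"
  have w: "?w \<in> hyperoctahedral n" "signed_length n ?w \<le> length js"
    "even (signed_length n ?w + length js)" and k: "k < n"
    using snoc by auto
  have "signed_length n (?w \<circ> gen k) = Suc (signed_length n ?w) \<or>
      signed_length n ?w = Suc (signed_length n (?w \<circ> gen k))"
    using signed_length_gen[OF w(1) k] signed_length_gen_Des[OF w(1), of k] not_Des[OF w(1) k] by blast
  hence "signed_length n (?w \<circ> gen k) \<le> Suc (length js)"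
    "even (signed_length n (?w \<circ> gen k) + Suc (length js))"
    using w by auto
  hence "?w \<circ> gen k \<in> hyperoctahedral n \<and> signed_length n (?w \<circ> gen k) \<le> length (js @ [k]) \<and>
      even (signed_length n (?w \<circ> gen k) + length (js @ [k]))"
    using hyp_comp[OF w(1) gen_hyp[OF k]] by simp
  thus ?case unfolding gen_word_snoc .
qed simp

text \<open>Bubble sort: a generator applied at a descent lowers the length by one, until no descent
  is left.\<close>

lemma gen_word_exists:
  assumes "w \<in> hyperoctahedral n"
  shows "\<exists>js. set js \<subseteq> {0..<n} \<and> length js = signed_length n w \<and> w = gen_word js"
  using assms
proof (induction "signed_length n w" arbitrary: w rule: less_induct)
  case less
  show ?case
  proof (cases "Des n w = {}")
    case True
    thus ?thesis using strict_mono_imp_id[OF less.prems] by (intro exI[of _ "[]"]) simp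
  next
    case False
    then obtain k where k: "k \<in> Des n w" by auto
    hence "k < n" by (simp add: Des_def)
    from signed_length_gen_Des[OF less.prems k] less.hyps[OF _ hyp_comp[OF less.prems gen_hyp[OF this]]]
    obtain js where js: "set js \<subseteq> {0..<n}" "length js = signed_length n (w \<circ> gen k)"
      "w \<circ> gen k = gen_word js" by auto
    have "w = gen_word (js @ [k])"
      unfolding gen_word_snoc js(3)[symmetric] comp_gen_gen ..
    thus ?thesis using js \<open>k < n\<close> signed_length_gen_Des[OF less.prems k]
      by (intro exI[of _ "js @ [k]"]) auto
  qed
qed

lemma cox_length_eq:
  assumes "w \<in> hyperoctahedral n"
  shows "cox_length n w = signed_length n w"
  unfolding cox_length_def gen_word_def[symmetric]
proof (rule Least_equality)
  show "\<exists>js. length js = signed_length n w \<and> set js \<subseteq> {0..<n} \<and> w = gen_word js"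
    using gen_word_exists[OF assms] by blast
  show "signed_length n w \<le> k" if "\<exists>js. length js = k \<and> set js \<subseteq> {0..<n} \<and> w = gen_word js" for k
    using that gen_word_length by blast
qed

text \<open>On the left it is not tracked whether the length rises or falls; a word gains one
  letter, and the parity of any word is that of the length.\<close>

lemma signed_length_gen_left:
  assumes w: "w \<in> hyperoctahedral n" and k: "k < n"
  shows "(- 1 :: 'a :: ring_1) ^ signed_length n (gen k \<circ> w) = - ((- 1) ^ signed_length n w)"
proof -
  obtain js where js: "set js \<subseteq> {0..<n}" "length js = signed_length n w" "w = gen_word js"
    using gen_word_exists[OF w] by blast
  have "even (signed_length n (gen_word (k # js)) + length (k # js))"
    using gen_word_length[of "k # js" n] js k by auto
  hence "even (signed_length n (gen k \<circ> w) + Suc (signed_length n w))"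
    using js by simp
  thus ?thesis by (auto simp: uminus_power_if)
qed

section \<open>Maximal parabolic quotients\<close>

text \<open>The minimal representatives of the left cosets of the parabolic subgroup generated by
  all s_i with i different from b. Such elements increase on -b..b and on b + 1..n.\<close>

definition maximal_quotient :: "nat \<Rightarrow> nat \<Rightarrow> (int \<Rightarrow> int) set" where
  "maximal_quotient n b = {u \<in> hyperoctahedral n. Des n u \<subseteq> {b}}"

lemma maximal_quotient_hyp: "u \<in> maximal_quotient n b \<Longrightarrow> u \<in> hyperoctahedral n"
  by (simp add: maximal_quotient_def)

lemma finite_maximal_quotient [simp]: "finite (maximal_quotient n b)"
  using finite_hyperoctahedral by (simp add: maximal_quotient_def)

lemma maximal_quotient_mono:
  assumes u: "u \<in> maximal_quotient n b" and "b \<le> n" "\<bar>i\<bar> \<le> int b" "\<bar>j\<bar> \<le> int b"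
  shows "u i < u j \<longleftrightarrow> i < j"
proof -
  have h: "u \<in> hyperoctahedral n" and d: "Des n u \<inter> {..<b} = {}"
    using u by (auto simp: maximal_quotient_def)
  show ?thesis
    using hyp_strict_mono[OF h d \<open>b \<le> n\<close>, of i j] hyp_strict_mono[OF h d \<open>b \<le> n\<close>, of j i] assms
    by (cases i j rule: linorder_cases) (auto simp: abs_le_iff)
qed

lemma Des_maximal_quotient_comp:
  assumes u: "u \<in> maximal_quotient n b" and v: "v \<in> hyperoctahedral b" and b: "b \<le> n"
  shows "Des n (u \<circ> v) \<inter> {..<b} = Des b v" "Des n (u \<circ> v) \<subseteq> {..b}"
proof -
  have "u (v (int i + 1)) < u (v (int i)) \<longleftrightarrow> v (int i + 1) < v (int i)" if "i < b" for i
    using that by (intro maximal_quotient_mono[OF u b]) (auto simp: hyp_abs_le_iff[OF v])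
  thus "Des n (u \<circ> v) \<inter> {..<b} = Des b v"
    using b by (auto simp: Des_def)
  have "i \<notin> Des n (u \<circ> v)" if "i > b" for i
    using that u hyp_fix[OF v, of "int i"] hyp_fix[OF v, of "int i + 1"]
    by (auto simp: Des_def maximal_quotient_def)
  thus "Des n (u \<circ> v) \<subseteq> {..b}" by (meson atMost_iff linorder_not_less subsetI)
qed

lemma bij_betw_maximal_quotient:
  assumes b: "b \<le> n"
  shows "bij_betw (\<lambda>(u, v). u \<circ> v) (maximal_quotient n b \<times> hyperoctahedral b)
    {w \<in> hyperoctahedral n. Des n w \<subseteq> {..b}}"
  unfolding bij_betw_def
proof (intro conjI subset_antisym)
  show "inj_on (\<lambda>(u, v). u \<circ> v) (maximal_quotient n b \<times> hyperoctahedral b)"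
  proof (rule inj_onI, clarify)
    fix u v u' v'
    assume u: "u \<in> maximal_quotient n b" and v: "v \<in> hyperoctahedral b"
      and u': "u' \<in> maximal_quotient n b" and v': "v' \<in> hyperoctahedral b"
      and eq: "u \<circ> v = u' \<circ> v'"
    \<comment> \<open>\<open>u = u' \<circ> t\<close>, and both \<open>u\<close> and
      \<open>u'\<close> increase on -b..b; hence \<open>t\<close> increases there and is the
      identity.\<close>
    define t where "t = v' \<circ> inv v"
    have t: "t \<in> hyperoctahedral b"
      unfolding t_def by (intro hyp_comp v' hyp_inv v)
    have ut: "u i = u' (t i)" for i
      using fun_cong[OF eq, of "inv v i"] by (simp add: t_def hyp_f_inv[OF v])
    have "t (int i) < t (int i + 1)" if "i < b" for i
    proof -
      have "u (int i) < u (int i + 1)"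
        using that maximal_quotient_mono[OF u b, of "int i" "int i + 1"] by simp
      thus ?thesis
        unfolding ut using that maximal_quotient_mono[OF u' b, of "t (int i)" "t (int i + 1)"]
        by (simp add: hyp_abs_le_iff[OF t])
    qed
    hence "Des b t = {}" by (force simp: Des_def)
    hence t_id: "t = id" by (rule strict_mono_imp_id[OF t])
    hence "u = u'" using ut by auto
    moreover have "v' x = v x" for x
      using fun_cong[OF t_id, of "v x"] by (simp add: t_def hyp_inv_f[OF v])
    ultimately show "u = u' \<and> v = v'" by auto
  qed
  show "(\<lambda>(u, v). u \<circ> v) ` (maximal_quotient n b \<times> hyperoctahedral b)
      \<subseteq> {w \<in> hyperoctahedral n. Des n w \<subseteq> {..b}}"
    using Des_maximal_quotient_comp(2)[OF _ _ b] hyp_comp hyp_mono[OF _ b] maximal_quotient_hyp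
    by fastforce
  have "\<exists>u v. u \<in> maximal_quotient n b \<and> v \<in> hyperoctahedral b \<and> w = u \<circ> v"
    if "w \<in> hyperoctahedral n" "Des n w \<subseteq> {..b}" for w
    using that
  proof (induction "signed_length n w" arbitrary: w rule: less_induct)
    case less
    note w = less.prems
    show ?case
    proof (cases "Des n w \<inter> {..<b} = {}")
      case True
      hence "Des n w \<subseteq> {b}"
        using w(2) by (auto simp: subset_iff order.order_iff_strict)
      thus ?thesis using w by (intro exI[of _ w] exI[of _ id]) (auto simp: maximal_quotient_def)
    next
      case False
      then obtain k where k: "k \<in> Des n w" "k < b" by auto
      \<comment> \<open>Sorting a descent k < b touches only positions up to b, so it creates no
        descent beyond b.\<close>
      let ?w = "w \<circ> gen k"
      have "i \<notin> Des n ?w" if "i > b" for i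
        using that k w(2) by (cases "k = 0") (auto simp: Des_def gen_0 gen_pos)
      hence "Des n ?w \<subseteq> {..b}" by (meson atMost_iff linorder_not_less subsetI)
      moreover have "?w \<in> hyperoctahedral n"
        using w(1) gen_hyp[of k n] k b by (intro hyp_comp) auto
      moreover have "signed_length n ?w < signed_length n w"
        using signed_length_gen_Des[OF w(1) k(1)] by simp
      ultimately obtain u v where uv: "u \<in> maximal_quotient n b" "v \<in> hyperoctahedral b"
        "?w = u \<circ> v" using less.hyps[of ?w] by blast
      have "w = u \<circ> (v \<circ> gen k)"
        using comp_gen_gen[of w k, symmetric] unfolding uv(3) comp_assoc .
      moreover have "v \<circ> gen k \<in> hyperoctahedral b" using uv gen_hyp[OF k(2)] hyp_comp by blast
      ultimately show ?thesis using uv(1) by blast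
    qed
  qed
  thus "{w \<in> hyperoctahedral n. Des n w \<subseteq> {..b}}
      \<subseteq> (\<lambda>(u, v). u \<circ> v) ` (maximal_quotient n b \<times> hyperoctahedral b)"
    by fastforce
qed

section \<open>Statistics along the parabolic factorization\<close>

definition outer_inversions ::
  "(int \<Rightarrow> int \<Rightarrow> bool) \<Rightarrow> nat \<Rightarrow> nat \<Rightarrow> (int \<Rightarrow> int) \<Rightarrow> (int \<times> int) set" where
  "outer_inversions R n b w = {(i, j) \<in> inversions R n w. int b < j}"

text \<open>\<open>u\<close> increases on -b..b, so positions of absolute value at most b compare
  under \<open>u \<circ> v\<close> as they do under \<open>v\<close>; only the pairs with j > b
  remain.\<close>

lemma card_inversions_comp:
  assumes u: "u \<in> maximal_quotient n b" and v: "v \<in> hyperoctahedral b" and b: "b \<le> n"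
  shows "card (inversions R n (u \<circ> v)) =
    card (inversions R b v) + card (outer_inversions R n b (u \<circ> v))"
proof -
  have "u (v j) < u (v i) \<longleftrightarrow> v j < v i" if "\<bar>i\<bar> < j" "j \<le> int b" for i j
    using that by (intro maximal_quotient_mono[OF u b]) (auto simp: hyp_abs_le_iff[OF v])
  hence "(i, j) \<in> inversions R n (u \<circ> v) \<longleftrightarrow>
      (i, j) \<in> inversions R b v \<union> outer_inversions R n b (u \<circ> v)" for i j
    using b by (cases "j \<le> int b") (auto simp: inversions_def outer_inversions_def)
  hence "inversions R n (u \<circ> v) = inversions R b v \<union> outer_inversions R n b (u \<circ> v)"
    by auto
  moreover have "inversions R b v \<inter> outer_inversions R n b (u \<circ> v) = {}"
    by (auto simp: inversions_def outer_inversions_def)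
  moreover have "finite (outer_inversions R n b (u \<circ> v))"
    unfolding outer_inversions_def by (rule finite_subset[OF _ finite_inversions]) auto
  ultimately show ?thesis by (simp add: card_Un_disjoint)
qed

lemma outer_inversions_maximal_quotient:
  assumes u: "u \<in> maximal_quotient n b" and b: "b \<le> n"
  shows "outer_inversions R n b u = inversions R n u"
proof -
  have "\<not> u j < u i" if "\<bar>i\<bar> < j" "j \<le> int b" for i j
    using maximal_quotient_mono[OF u b, of j i] that by auto
  thus ?thesis by (auto simp: outer_inversions_def inversions_def not_less[symmetric])
qed

text \<open>For j > b, \<open>t\<close> fixes j and merely relabels i; the counts agree as soon as
  \<open>R\<close> cannot tell \<open>t i\<close> from i.\<close>

lemma card_outer_inversions_comp:
  assumes t: "t \<in> hyperoctahedral b" and R: "\<And>i j. R (t i) j \<longleftrightarrow> R i j"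
  shows "card (outer_inversions R n b (w \<circ> t)) = card (outer_inversions R n b w)"
proof -
  have lt: "\<bar>t i\<bar> < j \<longleftrightarrow> \<bar>i\<bar> < j" and fix_j: "t j = j" if "int b < j" for i j
    using that hyp_abs_le_iff[OF t, of i] hyp_fix[OF t, of i] hyp_fix[OF t, of j] by auto
  have Ri: "R (inv t i) j \<longleftrightarrow> R i j" for i j
    using R[of "inv t i" j] by (simp add: hyp_f_inv[OF t])
  have lti: "\<bar>inv t i\<bar> < j \<longleftrightarrow> \<bar>i\<bar> < j" if "int b < j" for i j
    using lt[OF that, of "inv t i"] by (simp add: hyp_f_inv[OF t])
  have "bij_betw (\<lambda>(i, j). (t i, j)) (outer_inversions R n b (w \<circ> t)) (outer_inversions R n b w)"
    by (rule bij_betw_byWitness[where f' = "\<lambda>(i, j). (inv t i, j)"])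
       (auto simp: outer_inversions_def inversions_def hyp_inv_f[OF t] hyp_f_inv[OF t]
          lt lti R Ri fix_j)
  thus ?thesis by (rule bij_betw_same_card)
qed

lemma neg_comp:
  assumes u: "u \<in> maximal_quotient n b" and v: "v \<in> hyperoctahedral b" and b: "b \<le> n"
  shows "neg n (u \<circ> v) = neg n u + neg b v"
proof -
  have h: "u \<in> hyperoctahedral n" using u by (rule maximal_quotient_hyp)
  have sgn: "u i < 0 \<longleftrightarrow> i < 0" if "\<bar>i\<bar> \<le> int b" for i
    using maximal_quotient_mono[OF u b that, of 0] hyp_0[OF h] by simp
  have "{i \<in> {1..int n}. (u \<circ> v) i < 0} =
      {i \<in> {1..int n}. u i < 0} \<union> {i \<in> {1..int b}. v i < 0}" (is "_ = ?A \<union> ?B")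
  proof (intro set_eqI)
    fix i
    show "i \<in> {i \<in> {1..int n}. (u \<circ> v) i < 0} \<longleftrightarrow> i \<in> ?A \<union> ?B"
      using sgn[of i] sgn[of "v i"] hyp_fix[OF v, of i] hyp_abs_le_iff[OF v, of i] b
      by (cases "\<bar>i\<bar> \<le> int b") auto
  qed
  moreover have "?A \<inter> ?B = {}" using sgn by auto
  moreover have "finite ?A" "finite ?B" by (rule finite_Collect_conjI, simp)+
  ultimately show ?thesis unfolding neg_def by (simp only: card_Un_disjoint)
qed

lemma signed_length_comp:
  assumes u: "u \<in> maximal_quotient n b" and v: "v \<in> hyperoctahedral b" and b: "b \<le> n"
  shows "signed_length n (u \<circ> v) = signed_length n u + signed_length b v"
proof -
  have "card (outer_inversions (\<lambda>i j. i \<noteq> 0) n b (u \<circ> v)) = card (inversions (\<lambda>i j. i \<noteq> 0) n u)"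
    by (subst card_outer_inversions_comp[OF v])
       (simp_all add: hyp_eq_0_iff[OF v] outer_inversions_maximal_quotient[OF u b])
  thus ?thesis
    unfolding signed_length_def using card_inversions_comp[OF assms] neg_comp[OF assms] by simp
qed

text \<open>This is the odd length, see \<open>odd_length_eq\<close>: the factor 1/2 is replaced by
  choosing one pair from each mirror couple. Pairs with i = 0 belong to it.\<close>

definition parity_inversions :: "nat \<Rightarrow> (int \<Rightarrow> int) \<Rightarrow> nat" where
  "parity_inversions n w = card (inversions (\<lambda>i j. odd (i + j)) n w)"

text \<open>Here and in \<open>odd_weight\<close>, \<open>Y\<close> will be the inverse of X; these
  are the parts of the summands that are not expressed through the descent set.\<close>

definition neg_weight :: "'a :: comm_ring_1 \<Rightarrow> nat \<Rightarrow> (int \<Rightarrow> int) \<Rightarrow> 'a" where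
  "neg_weight Y n w = (- 1) ^ neg n w * Y ^ signed_length n w"

definition odd_weight :: "'a :: comm_ring_1 \<Rightarrow> nat \<Rightarrow> (int \<Rightarrow> int) \<Rightarrow> 'a" where
  "odd_weight Y n w = (- 1) ^ signed_length n w * Y ^ parity_inversions n w"

lemma neg_weight_comp:
  assumes "u \<in> maximal_quotient n b" "v \<in> hyperoctahedral b" "b \<le> n"
  shows "neg_weight Y n (u \<circ> v) = neg_weight Y n u * neg_weight Y b v"
  by (simp add: neg_weight_def signed_length_comp[OF assms] neg_comp[OF assms] power_add
      mult.assoc mult.left_commute)

section \<open>Exchanging adjacent values at positions of equal parity\<close>

context
  fixes v :: "int \<Rightarrow> int" and b k :: nat
  assumes v: "v \<in> hyperoctahedral b" and k: "k < b"
    and par: "even (inv v (int k) + inv v (int k + 1))"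
begin

text \<open>Negating a value negates its position, which keeps the parity; so all values of absolute
  value k or k + 1 sit at positions of one parity.\<close>

lemma even_position:
  assumes "\<bar>v i\<bar> \<in> {int k, int k + 1}"
  shows "even (i + inv v (int k))"
proof -
  have "v i \<in> {int k, - int k, int k + 1, - (int k + 1)}" using assms by auto
  hence "i \<in> {inv v (int k), inv v (- int k), inv v (int k + 1), inv v (- (int k + 1))}"
    by (metis hyp_inv_f[OF v] empty_iff insert_iff)
  hence "i \<in> {inv v (int k), - inv v (int k), inv v (int k + 1), - inv v (int k + 1)}"
    by (simp only: hyp_minus[OF hyp_inv[OF v]])
  thus ?thesis using par by auto
qed

text \<open>Only comparisons among the exchanged values can change, and those occupy positions of
  one parity. Descents compare neighbouring positions and the odd length compares positions of
  opposite parity, so neither notices the exchange.\<close>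

lemma gen_comp_less_iff:
  assumes "odd (i + j)"
  shows "gen k (v i) < gen k (v j) \<longleftrightarrow> v i < v j"
proof (rule gen_less_iff, rule notI)
  assume "\<bar>v i\<bar> \<in> {int k, int k + 1} \<and> \<bar>v j\<bar> \<in> {int k, int k + 1}"
  hence "even (i + inv v (int k))" "even (j + inv v (int k))"
    using even_position by blast+
  thus False using assms by presburger
qed

lemma Des_gen_comp: "Des b (gen k \<circ> v) = Des b v"
proof -
  have "gen k (v (i + 1)) < gen k (v i) \<longleftrightarrow> v (i + 1) < v i" for i
    by (rule gen_comp_less_iff) presburger
  thus ?thesis by (simp add: Des_def)
qed

lemma parity_inversions_gen_comp:
  "inversions (\<lambda>i j. odd (i + j)) b (gen k \<circ> v) = inversions (\<lambda>i j. odd (i + j)) b v"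
  using gen_comp_less_iff by (auto simp: inversions_def add.commute)

text \<open>Under \<open>u\<close> the exchanged values need no longer be adjacent, so comparisons
  may change. Conjugation by \<open>v\<close> turns the exchange into a permutation \<open>t\<close>
  of positions; it preserves parity and relabels the pairs.\<close>

lemma outer_inversions_gen_comp:
  "card (outer_inversions (\<lambda>i j. odd (i + j)) n b (u \<circ> (gen k \<circ> v))) =
   card (outer_inversions (\<lambda>i j. odd (i + j)) n b (u \<circ> v))"
proof -
  define t where "t = inv v \<circ> (gen k \<circ> v)"
  have t: "t \<in> hyperoctahedral b"
    unfolding t_def by (intro hyp_comp hyp_inv v gen_hyp k)
  have vt: "v (t i) = gen k (v i)" for i
    by (simp add: t_def hyp_f_inv[OF v])
  have "even (t i + i)" for i
  proof (cases "\<bar>v i\<bar> \<in> {int k, int k + 1}")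
    case True
    hence "\<bar>v (t i)\<bar> \<in> {int k, int k + 1}"
      unfolding vt by (cases "k = 0") (auto simp: gen_0 gen_pos)
    thus ?thesis using even_position[OF True] even_position[of "t i"] by presburger
  next
    case False
    hence "v (t i) = v i"
      unfolding vt by (cases "k = 0") (auto simp: gen_0 gen_pos)
    thus ?thesis by (simp add: hyp_eq_iff[OF v])
  qed
  hence R: "odd (t i + j) \<longleftrightarrow> odd (i + j)" for i j
    by (metis even_add)
  have "u \<circ> (gen k \<circ> v) = (u \<circ> v) \<circ> t"
    using vt by (auto simp: fun_eq_iff)
  thus ?thesis using card_outer_inversions_comp[OF t, of "\<lambda>i j. odd (i + j)", OF R] by metis
qed

end

lemma odd_weight_gen_comp:
  fixes Y :: "'a :: comm_ring_1"
  assumes "v \<in> hyperoctahedral b" "k < b" "even (inv v (int k) + inv v (int k + 1))"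
    and u: "u \<in> maximal_quotient n b" and b: "b \<le> n"
  shows "odd_weight Y n (u \<circ> (gen k \<circ> v)) = - odd_weight Y n (u \<circ> v)"
proof -
  have gv: "gen k \<circ> v \<in> hyperoctahedral b" using assms by (intro hyp_comp gen_hyp)
  have "parity_inversions n (u \<circ> (gen k \<circ> v)) = parity_inversions n (u \<circ> v)"
    unfolding parity_inversions_def
      card_inversions_comp[OF u gv b] card_inversions_comp[OF u assms(1) b]
      parity_inversions_gen_comp[OF assms(1-3)] outer_inversions_gen_comp[OF assms(1-3)] ..
  thus ?thesis
    unfolding odd_weight_def signed_length_comp[OF u gv b] signed_length_comp[OF u assms(1) b]
      power_add signed_length_gen_left[OF assms(1,2)] by simp
qed

text \<open>
  The alternating sum over all \<open>v\<close> collapses to the parity preserving ones: otherwise let \<open>a\<close>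
  be the least value at a position of the wrong parity. The values \<open>a - 1\<close> and \<open>a\<close> (for \<open>a = 1\<close>,
  the values \<open>- 1\<close> and \<open>1\<close>) then have positions of equal parity, and exchanging them is a
  sign-reversing involution.
\<close>

definition parity_preserving :: "(int \<Rightarrow> int) \<Rightarrow> bool" where
  "parity_preserving v \<longleftrightarrow> (\<forall>i. even (v i + i))"

definition misplaced :: "(int \<Rightarrow> int) \<Rightarrow> nat \<Rightarrow> bool" where
  "misplaced v a \<longleftrightarrow> a > 0 \<and> odd (inv v (int a) + int a)"

definition first_swap :: "(int \<Rightarrow> int) \<Rightarrow> int \<Rightarrow> int" where
  "first_swap v = gen ((LEAST a. misplaced v a) - 1) \<circ> v"

lemma misplaced_exists:
  assumes v: "v \<in> hyperoctahedral b" and np: "\<not> parity_preserving v"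
  shows "\<exists>a. misplaced v a"
proof (rule ccontr)
  assume none: "\<nexists>a. misplaced v a"
  have pos: "even (inv v (int a) + int a)" for a
  proof (cases "a = 0")
    case True
    thus ?thesis using hyp_0[OF hyp_inv[OF v]] by simp
  next
    case False
    thus ?thesis using none unfolding misplaced_def by blast
  qed
  have "even (inv v j + j)" for j
    using pos[of "nat \<bar>j\<bar>"] hyp_minus[OF hyp_inv[OF v], of j] by (cases "j \<ge> 0") auto
  from this[of "v i" for i] have "even (i + v i)" for i
    by (simp only: hyp_inv_f[OF v])
  hence "parity_preserving v" by (simp add: parity_preserving_def add.commute)
  thus False using np by blast
qed

lemma first_swap:
  assumes v: "v \<in> hyperoctahedral b" and np: "\<not> parity_preserving v"
  obtains k where "k < b" "even (inv v (int k) + inv v (int k + 1))" "first_swap v = gen k \<circ> v"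
    "first_swap (gen k \<circ> v) = v" "\<not> parity_preserving (gen k \<circ> v)"
proof -
  define a where "a = (LEAST a. misplaced v a)"
  have mis: "misplaced v a"
    unfolding a_def using misplaced_exists[OF assms] by (rule LeastI_ex)
  have least: "\<not> misplaced v c" if "c < a" for c
    using that not_less_Least unfolding a_def by blast
  define k where "k = a - 1"
  have a: "a = Suc k" using mis by (simp add: k_def misplaced_def)
  have k: "k < b"
  proof (rule ccontr)
    assume "\<not> k < b"
    hence "inv v (int a) = int a" by (intro hyp_fix[OF hyp_inv[OF v]]) (simp add: a)
    thus False using mis by (simp add: misplaced_def)
  qed
  have pk: "even (inv v (int k) + int k)"
    using least[of k] a hyp_0[OF hyp_inv[OF v]] by (cases "k = 0") (auto simp: misplaced_def)
  have pa: "odd (inv v (int k + 1) + (int k + 1))"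
    using mis by (simp add: misplaced_def a add.commute)
  \<comment> \<open>k is at a position of its own parity, k + 1 is not, and k and k + 1 differ in
    parity.\<close>
  have par: "even (inv v (int k) + inv v (int k + 1))"
    using pk pa by presburger
  have swap: "first_swap v = gen k \<circ> v"
    by (simp add: first_swap_def k_def a_def)
  have inv_gen: "inv (gen k \<circ> v) c = inv v (gen k c)" for c
  proof -
    have "gen k \<circ> v \<in> hyperoctahedral b" by (intro hyp_comp gen_hyp k v)
    from hyp_inv_f[OF this, of "inv v (gen k c)"] show ?thesis
      by (simp add: hyp_f_inv[OF v])
  qed
  have mis': "misplaced (gen k \<circ> v) a"
  proof (cases "k = 0")
    case True
    have "inv v (- 1) = - inv v 1" by (rule hyp_minus[OF hyp_inv[OF v]])
    thus ?thesis using pa True unfolding misplaced_def inv_gen by (simp add: a gen_0)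
  next
    case False
    thus ?thesis using pk unfolding misplaced_def inv_gen by (simp add: a gen_pos add.commute)
  qed
  \<comment> \<open>The old position of k + 1 has the parity of k, so k is well placed after the
    exchange too. Hence \<open>a\<close> remains the least misplaced value, and
    \<open>first_swap\<close> undoes itself.\<close>
  have least': "\<not> misplaced (gen k \<circ> v) c" if "c < a" for c
  proof (cases "c < k \<or> c = 0")
    case True
    hence "c = 0 \<or> gen k (int c) = int c" using a by (cases "k = 0") (auto simp: gen_pos)
    thus ?thesis using least[OF that] unfolding misplaced_def inv_gen by auto
  next
    case False
    hence "c = k" "k > 0" using that a by auto
    thus ?thesis using pa unfolding misplaced_def inv_gen by (simp add: gen_pos)
  qed
  have "(LEAST a. misplaced (gen k \<circ> v) a) = a"
    using mis' least' by (intro Least_equality) (auto simp: not_less[symmetric])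
  hence "first_swap (gen k \<circ> v) = v"
    by (auto simp: first_swap_def a fun_eq_iff)
  moreover have "\<not> parity_preserving (gen k \<circ> v)"
  proof
    assume "parity_preserving (gen k \<circ> v)"
    hence "even ((gen k \<circ> v) (inv (gen k \<circ> v) (int a)) + inv (gen k \<circ> v) (int a))"
      by (simp add: parity_preserving_def)
    moreover have "gen k \<circ> v \<in> hyperoctahedral b" by (intro hyp_comp gen_hyp k v)
    ultimately show False using mis' hyp_f_inv by (metis add.commute misplaced_def)
  qed
  ultimately show ?thesis using that k par swap by blast
qed

lemma sum_not_parity_preserving:
  fixes Y :: "'a :: field_char_0"
  assumes u: "u \<in> maximal_quotient n b" and b: "b \<le> n"
  shows "(\<Sum>v | v \<in> hyperoctahedral b \<and> \<not> parity_preserving v.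
      odd_weight Y n (u \<circ> v) * g (Des b v)) = 0" (is "sum ?f ?A = 0")
proof -
  have step: "first_swap v \<in> ?A \<and> first_swap (first_swap v) = v \<and> ?f (first_swap v) = - ?f v"
    if "v \<in> ?A" for v
  proof -
    from that have v: "v \<in> hyperoctahedral b" "\<not> parity_preserving v" by auto
    obtain k where k: "k < b" "even (inv v (int k) + inv v (int k + 1))"
      "first_swap v = gen k \<circ> v" "first_swap (gen k \<circ> v) = v" "\<not> parity_preserving (gen k \<circ> v)"
      using first_swap[OF v] by blast
    show ?thesis
      unfolding k(3,4) odd_weight_gen_comp[OF v(1) k(1,2) u b] Des_gen_comp[OF v(1) k(1,2)]
      using k(5) hyp_comp[OF gen_hyp[OF k(1)] v(1)] by simp
  qed
  have "sum ?f ?A = (\<Sum>v\<in>?A. - ?f v)"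
    by (rule sum.reindex_bij_witness[of _ first_swap first_swap]) (use step in \<open>auto\<close>)
  hence "sum ?f ?A = - sum ?f ?A" by (simp only: sum_negf)
  hence "2 * sum ?f ?A = 0" by (simp only: mult_2 eq_neg_iff_add_eq_0)
  thus ?thesis by simp
qed

lemma id_maximal_quotient [simp]: "id \<in> maximal_quotient n b"
  by (auto simp: maximal_quotient_def Des_def)

text \<open>For a parity preserving \<open>v\<close> the pairs with j > b are relabelled without a
  change of parity, so the odd length is additive. The other \<open>v\<close> cancel on both sides:
  on the left with \<open>u\<close>, on the right with \<open>id\<close> in its place.\<close>

lemma odd_weight_comp_sum:
  fixes Y :: "'a :: field_char_0"
  assumes u: "u \<in> maximal_quotient n b" and b: "b \<le> n"
  shows "(\<Sum>v\<in>hyperoctahedral b. odd_weight Y n (u \<circ> v) * g (Des b v)) =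
    odd_weight Y n u * (\<Sum>v\<in>hyperoctahedral b. odd_weight Y b v * g (Des b v))"
proof -
  let ?C = "{v. v \<in> hyperoctahedral b \<and> parity_preserving v}"
  have split: "(\<Sum>v\<in>hyperoctahedral b. odd_weight Y m (t \<circ> v) * g (Des b v)) =
      (\<Sum>v\<in>?C. odd_weight Y m (t \<circ> v) * g (Des b v))" if "t \<in> maximal_quotient m b" "b \<le> m" for t m
  proof -
    have "hyperoctahedral b = ?C \<union> {v. v \<in> hyperoctahedral b \<and> \<not> parity_preserving v}" by auto
    thus ?thesis
      using finite_hyperoctahedral[of b] sum_not_parity_preserving[OF that, of Y g]
      by (subst \<open>hyperoctahedral b = _\<close>, subst sum.union_disjoint) auto
  qed
  have chess: "odd_weight Y n (u \<circ> v) = odd_weight Y n u * odd_weight Y b v" if "v \<in> ?C" for v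
  proof -
    have v: "v \<in> hyperoctahedral b" and p: "\<And>i. even (v i + i)"
      using that by (auto simp: parity_preserving_def)
    have "odd (v i + j) \<longleftrightarrow> odd (i + j)" for i j
      using p[of i] by (metis even_add)
    hence "parity_inversions n (u \<circ> v) = parity_inversions n u + parity_inversions b v"
      unfolding parity_inversions_def card_inversions_comp[OF u v b]
      by (subst card_outer_inversions_comp[OF v])
         (simp_all add: outer_inversions_maximal_quotient[OF u b])
    thus ?thesis
      by (simp add: odd_weight_def signed_length_comp[OF u v b] power_add mult.assoc
          mult.left_commute)
  qed
  have "(\<Sum>v\<in>?C. odd_weight Y n (u \<circ> v) * g (Des b v)) =
      odd_weight Y n u * (\<Sum>v\<in>?C. odd_weight Y b v * g (Des b v))"
    unfolding sum_distrib_left by (intro sum.cong refl) (simp add: chess mult.assoc)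
  thus ?thesis
    using split[OF u b] split[of id b] by simp
qed

section \<open>Descent generating functions\<close>

definition descent_sum ::
  "(nat \<Rightarrow> (int \<Rightarrow> int) \<Rightarrow> 'a :: comm_ring_1) \<Rightarrow> (nat \<Rightarrow> 'a) \<Rightarrow> nat \<Rightarrow> 'a" where
  "descent_sum wt x n = (\<Sum>w\<in>hyperoctahedral n. wt n w * (\<Prod>i\<in>Des n w. x i))"

definition quotient_sum ::
  "(nat \<Rightarrow> (int \<Rightarrow> int) \<Rightarrow> 'a :: comm_ring_1) \<Rightarrow> nat \<Rightarrow> nat \<Rightarrow> 'a" where
  "quotient_sum wt n b = (\<Sum>u\<in>maximal_quotient n b. wt n u)"

text \<open>
  Inclusion-exclusion over the supersets \<open>I\<close> of \<open>D\<close>, grouped by \<open>b = Max I\<close>.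
\<close>

lemma prod_subset_expand:
  fixes x :: "nat \<Rightarrow> 'a :: comm_ring_1"
  assumes "D \<subseteq> {..<n}"
  shows "(\<Prod>i\<in>D. x i) = (if D = {} then \<Prod>i<n. 1 - x i else 0) +
    (\<Sum>b<n. if D \<subseteq> {..b} then x b * (\<Prod>i\<in>{b<..<n}. 1 - x i) * (\<Prod>i\<in>D \<inter> {..<b}. x i) else 0)"
  using assms
proof (induction n arbitrary: D)
  case 0
  thus ?case by simp
next
  case (Suc n)
  have ivl: "{b<..<Suc n} = insert n {b<..<n}" if "b < n" for b using that by auto
  have last: "D \<subseteq> {..n}" "{n<..<Suc n} = {}" using Suc.prems by auto
  show ?case
  proof (cases "n \<in> D")
    case False
    have D: "D \<subseteq> {..<n}" using False Suc.prems by (auto simp: less_Suc_eq)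
    hence [simp]: "D \<inter> {..<n} = D" by auto
    let ?e = "if D = {} then \<Prod>i<n. 1 - x i else 0"
    let ?s = "\<Sum>b<n. if D \<subseteq> {..b} then x b * (\<Prod>i\<in>{b<..<n}. 1 - x i) * (\<Prod>i\<in>D \<inter> {..<b}. x i) else 0"
    let ?e' = "if D = {} then \<Prod>i<Suc n. 1 - x i else 0"
    let ?s' = "\<Sum>b<n. if D \<subseteq> {..b} then x b * (\<Prod>i\<in>{b<..<Suc n}. 1 - x i) * (\<Prod>i\<in>D \<inter> {..<b}. x i) else 0"
    have s': "?s' = (1 - x n) * ?s"
      unfolding sum_distrib_left by (intro sum.cong refl) (auto simp: ivl)
    have e': "?e' = (1 - x n) * ?e" by simp
    have IH: "(\<Prod>i\<in>D. x i) = ?e + ?s" by (rule Suc.IH[OF D])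
    have top: "(if D \<subseteq> {..n} then x n * (\<Prod>i\<in>{n<..<Suc n}. 1 - x i) * (\<Prod>i\<in>D \<inter> {..<n}. x i) else 0)
        = x n * (?e + ?s)"
      using last IH by simp
    have "?e + ?s = (1 - x n) * ?e + ((1 - x n) * ?s + x n * (?e + ?s))"
      by (simp only: algebra_simps) simp
    thus ?thesis
      unfolding sum.lessThan_Suc s' e' top IH .
  next
    case True
    have "\<not> D \<subseteq> {..b}" if "b < n" for b using True that by auto
    hence zero: "(\<Sum>b<n. if D \<subseteq> {..b} then x b * (\<Prod>i\<in>{b<..<Suc n}. 1 - x i) * (\<Prod>i\<in>D \<inter> {..<b}. x i) else 0) = 0"
      by (intro sum.neutral ballI) simp
    have "D - {n} = D \<inter> {..<n}" using Suc.prems by (auto simp: less_Suc_eq)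
    hence prod_D: "(\<Prod>i\<in>D. x i) = x n * (\<Prod>i\<in>D \<inter> {..<n}. x i)"
      using prod.remove[of D n x] True finite_subset[OF Suc.prems] by simp
    have "D \<noteq> {}" using True by auto
    thus ?thesis using last by (simp add: zero prod_D)
  qed
qed

text \<open>Multiplicativity is required in summed form only, which is all that the odd length
  offers.\<close>

lemma descent_sum_rec:
  fixes x :: "nat \<Rightarrow> 'a :: comm_ring_1"
  assumes mult: "\<And>b u. b < n \<Longrightarrow> u \<in> maximal_quotient n b \<Longrightarrow>
      (\<Sum>v\<in>hyperoctahedral b. wt n (u \<circ> v) * (\<Prod>i\<in>Des b v. x i)) = wt n u * descent_sum wt x b"
    and id: "wt n id = 1"
  shows "descent_sum wt x n = (\<Prod>i<n. 1 - x i) +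
    (\<Sum>b<n. x b * (\<Prod>i\<in>{b<..<n}. 1 - x i) * quotient_sum wt n b * descent_sum wt x b)"
proof -
  let ?B = "hyperoctahedral n"
  let ?c = "\<lambda>b. x b * (\<Prod>i\<in>{b<..<n}. 1 - x i)"
  have fin: "finite ?B" by (rule finite_hyperoctahedral)
  have "descent_sum wt x n = (\<Sum>w\<in>?B. wt n w * (if Des n w = {} then \<Prod>i<n. 1 - x i else 0)) +
    (\<Sum>w\<in>?B. \<Sum>b<n. wt n w * (if Des n w \<subseteq> {..b} then ?c b * (\<Prod>i\<in>Des n w \<inter> {..<b}. x i) else 0))"
    unfolding descent_sum_def sum_distrib_left[symmetric] sum.distrib[symmetric]
      distrib_left[symmetric]
    by (intro sum.cong refl arg_cong2[where f = "(*)"] prod_subset_expand) (auto simp: Des_def)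
  also have "(\<Sum>w\<in>?B. wt n w * (if Des n w = {} then \<Prod>i<n. 1 - x i else 0)) =
      (\<Sum>w\<in>{id}. wt n w * (if Des n w = {} then \<Prod>i<n. 1 - x i else 0))"
    using fin strict_mono_imp_id[of _ n] by (intro sum.mono_neutral_right) auto
  also have "\<dots> = (\<Prod>i<n. 1 - x i)"
    using id by (simp add: Des_def)
  also have "(\<Sum>w\<in>?B. \<Sum>b<n. wt n w * (if Des n w \<subseteq> {..b} then ?c b * (\<Prod>i\<in>Des n w \<inter> {..<b}. x i) else 0))
     = (\<Sum>b<n. \<Sum>w\<in>?B. wt n w * (if Des n w \<subseteq> {..b} then ?c b * (\<Prod>i\<in>Des n w \<inter> {..<b}. x i) else 0))"
    by (rule sum.swap)
  also have "\<dots> = (\<Sum>b<n. ?c b * quotient_sum wt n b * descent_sum wt x b)"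
  proof (intro sum.cong refl)
    fix b assume "b \<in> {..<n}"
    hence b: "b < n" "b \<le> n" by auto
    let ?g = "\<lambda>w. wt n w * (?c b * (\<Prod>i\<in>Des n w \<inter> {..<b}. x i))"
    have "(\<Sum>w\<in>?B. wt n w * (if Des n w \<subseteq> {..b} then ?c b * (\<Prod>i\<in>Des n w \<inter> {..<b}. x i) else 0))
      = (\<Sum>w | w \<in> ?B \<and> Des n w \<subseteq> {..b}. ?g w)"
      using fin by (intro sum.mono_neutral_cong_right) auto
    also have "\<dots> = (\<Sum>(u, v)\<in>maximal_quotient n b \<times> hyperoctahedral b. ?g (u \<circ> v))"
      by (subst sum.reindex_bij_betw[OF bij_betw_maximal_quotient[OF b(2)], symmetric])
         (simp add: case_prod_unfold)
    also have "\<dots> = (\<Sum>u\<in>maximal_quotient n b. \<Sum>v\<in>hyperoctahedral b. ?g (u \<circ> v))"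
      by (rule sum.cartesian_product[symmetric])
    also have "\<dots> = (\<Sum>u\<in>maximal_quotient n b. ?c b * (wt n u * descent_sum wt x b))"
    proof (intro sum.cong refl)
      fix u assume u: "u \<in> maximal_quotient n b"
      have "(\<Sum>v\<in>hyperoctahedral b. ?g (u \<circ> v)) =
          ?c b * (\<Sum>v\<in>hyperoctahedral b. wt n (u \<circ> v) * (\<Prod>i\<in>Des b v. x i))"
        unfolding sum_distrib_left
        by (intro sum.cong refl)
           (simp add: Des_maximal_quotient_comp(1)[OF u _ b(2)] mult.left_commute)
      thus "(\<Sum>v\<in>hyperoctahedral b. ?g (u \<circ> v)) = ?c b * (wt n u * descent_sum wt x b)"
        unfolding mult[OF b(1) u] .
    qed
    also have "\<dots> = ?c b * quotient_sum wt n b * descent_sum wt x b"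
      by (simp add: quotient_sum_def sum_distrib_left sum_distrib_right mult.assoc)
    finally show "(\<Sum>w\<in>?B. wt n w * (if Des n w \<subseteq> {..b} then ?c b * (\<Prod>i\<in>Des n w \<inter> {..<b}. x i) else 0))
      = ?c b * quotient_sum wt n b * descent_sum wt x b" .
  qed
  finally show ?thesis .
qed

text \<open>Divide \<open>descent_sum_rec\<close> by the product of \<open>1 - x i\<close> over i <
  n: the quotients of \<open>descent_sum\<close> by the product over i \<le> n then solve a
  triangular linear system, which \<open>P\<close> solves up to the scaling \<open>K\<close>. The
  separate term \<open>x n * P n\<close> is the summand b = n, where the quotient consists of
  \<open>id\<close> alone.\<close>

lemma descent_sum_closed:
  fixes x :: "nat \<Rightarrow> 'a :: comm_ring_1"
  assumes mult: "\<And>n b u. b < n \<Longrightarrow> u \<in> maximal_quotient n b \<Longrightarrow>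
      (\<Sum>v\<in>hyperoctahedral b. wt n (u \<circ> v) * (\<Prod>i\<in>Des b v. x i)) = wt n u * descent_sum wt x b"
    and id: "\<And>n. wt n id = 1"
    and P: "\<And>n. P n = K + x n * P n + (\<Sum>b<n. quotient_sum wt n b * x b * P b)"
  shows "K * descent_sum wt x n = (\<Prod>i\<le>n. 1 - x i) * P n"
proof (induction n rule: less_induct)
  case (less n)
  let ?T = "descent_sum wt x"
  have split: "(\<Prod>i\<le>b. 1 - x i) * (\<Prod>i\<in>{b<..<n}. 1 - x i) = (\<Prod>i<n. 1 - x i)" if "b < n" for b
  proof -
    have "{..b} \<union> {b<..<n} = {..<n}" using that by auto
    moreover have "(\<Prod>i\<le>b. 1 - x i) * (\<Prod>i\<in>{b<..<n}. 1 - x i) =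
        (\<Prod>i\<in>{..b} \<union> {b<..<n}. 1 - x i)"
      by (rule prod.union_disjoint[symmetric]) auto
    ultimately show ?thesis by simp
  qed
  have "K * ?T n = K * (\<Prod>i<n. 1 - x i) +
      (\<Sum>b<n. x b * (\<Prod>i\<in>{b<..<n}. 1 - x i) * quotient_sum wt n b * (K * ?T b))"
    by (subst descent_sum_rec[OF mult id])
       (simp_all only: distrib_left sum_distrib_left mult.left_commute)
  also have "(\<Sum>b<n. x b * (\<Prod>i\<in>{b<..<n}. 1 - x i) * quotient_sum wt n b * (K * ?T b)) =
      (\<Sum>b<n. (\<Prod>i<n. 1 - x i) * (quotient_sum wt n b * x b * P b))"
    by (intro sum.cong refl) (simp add: less.IH split[symmetric] mult_ac)
  also have "K * (\<Prod>i<n. 1 - x i) + \<dots> =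
      (\<Prod>i<n. 1 - x i) * (K + (\<Sum>b<n. quotient_sum wt n b * x b * P b))"
    by (simp add: sum_distrib_left distrib_left mult.commute)
  also have "K + (\<Sum>b<n. quotient_sum wt n b * x b * P b) = (1 - x n) * P n"
    using P[of n] by (simp add: algebra_simps)
  finally show ?case by (simp add: lessThan_Suc_atMost[symmetric] mult_ac)
qed

section \<open>Insertion of the top value\<close>

text \<open>
  Precomposition with this permutation puts the top value \<open>s * (n + 1)\<close> into position \<open>p\<close> and
  moves the old entries from \<open>p\<close> on up by one position.
\<close>

definition insertion :: "nat \<Rightarrow> int \<Rightarrow> nat \<Rightarrow> int \<Rightarrow> int" where
  "insertion p s n i =
    (if i = int p then s * (int n + 1) else if i = - int p then - s * (int n + 1)
     else if int p < i \<and> i \<le> int n + 1 then i - 1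
     else if i < - int p \<and> - int n - 1 \<le> i then i + 1 else i)"

context
  fixes p n :: nat and s :: int
  assumes p: "0 < p" "p \<le> Suc n" and s: "s = 1 \<or> s = - 1"
begin

lemma insertion_minus: "insertion p s n (- i) = - insertion p s n i"
  using p by (auto simp: insertion_def)

lemma insertion_less:
  "i < j \<Longrightarrow> \<bar>i\<bar> \<noteq> int p \<Longrightarrow> \<bar>j\<bar> \<noteq> int p \<Longrightarrow> insertion p s n i < insertion p s n j"
  using p by (auto simp: insertion_def)

lemma insertion_hyp: "insertion p s n \<in> hyperoctahedral (Suc n)"
proof -
  have top: "\<bar>insertion p s n i\<bar> = int n + 1" if "\<bar>i\<bar> = int p" for i
    using that s p by (auto simp: insertion_def abs_eq_iff')
  have nontop: "\<bar>insertion p s n i\<bar> \<noteq> int n + 1" if "\<bar>i\<bar> \<noteq> int p" for i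
    using that p by (auto simp: insertion_def)
  have "inj (insertion p s n)"
  proof (rule injI, rule ccontr)
    fix i j assume eq: "insertion p s n i = insertion p s n j" and neq: "i \<noteq> j"
    show False
    proof (cases "\<bar>i\<bar> = int p")
      case True
      hence "\<bar>j\<bar> = int p" using top[of i] nontop[of j] eq by auto
      hence "j = - i" using True neq by (auto simp: abs_eq_iff')
      thus False using eq top[OF True] insertion_minus[of i] by simp
    next
      case False
      hence "\<bar>j\<bar> \<noteq> int p" using top[of j] nontop[of i] eq by auto
      thus False using insertion_less[of i j] insertion_less[of j i] False eq neq by fastforce
    qed
  qed
  moreover have "\<bar>insertion p s n i\<bar> \<le> int (Suc n)" if "\<bar>i\<bar> \<le> int (Suc n)" for i
    using that p s by (auto simp: insertion_def)
  moreover have "insertion p s n i = i" if "\<bar>i\<bar> > int (Suc n)" for i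
    using that p by (auto simp: insertion_def)
  ultimately show ?thesis
    using insertion_minus by (simp add: hyperoctahedral_iff)
qed

lemma insertion_bound: "\<bar>i\<bar> \<le> int (Suc n) \<Longrightarrow> \<bar>i\<bar> \<noteq> int p \<Longrightarrow> \<bar>insertion p s n i\<bar> \<le> int n"
  using p by (auto simp: insertion_def)

context
  fixes w :: "int \<Rightarrow> int"
  assumes w: "w \<in> hyperoctahedral n"
begin

lemma comp_insertion_at: "(w \<circ> insertion p s n) (int p) = s * (int n + 1)"
  "(w \<circ> insertion p s n) (- int p) = - s * (int n + 1)"
  using s p hyp_fix[OF w, of "int n + 1"] hyp_fix[OF w, of "- 1 - int n"]
  by (auto simp: insertion_def add.commute)

lemma comp_insertion_bound:
  "\<bar>i\<bar> \<le> int (Suc n) \<Longrightarrow> \<bar>i\<bar> \<noteq> int p \<Longrightarrow> \<bar>(w \<circ> insertion p s n) i\<bar> \<le> int n"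
  using insertion_bound[of i] by (simp add: hyp_abs_le_iff[OF w])

text \<open>Descents before the gap keep their index, those after it move up by one. The old
  comparison at p - 1 is lost, and the new indices p - 1 and p involve the inserted value.\<close>

lemma Des_comp_insertion:
  "Suc i < p \<Longrightarrow> i \<in> Des (Suc n) (w \<circ> insertion p s n) \<longleftrightarrow> i \<in> Des n w"
  "p \<le> i \<Longrightarrow> Suc i \<in> Des (Suc n) (w \<circ> insertion p s n) \<longleftrightarrow> i \<in> Des n w"
  using p by (auto simp: Des_def insertion_def add.commute)

lemma Des_comp_insertion_top:
  "s = 1 \<Longrightarrow> p - 1 \<notin> Des (Suc n) (w \<circ> insertion p s n)"
  "s = - 1 \<Longrightarrow> p \<notin> Des (Suc n) (w \<circ> insertion p s n)"
proof -
  assume s1: "s = 1"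
  have "(w \<circ> insertion p s n) (int (p - 1)) \<le> int n"
    using comp_insertion_bound[of "int (p - 1)"] p by auto
  moreover have "(w \<circ> insertion p s n) (int (p - 1) + 1) = int n + 1"
    using comp_insertion_at s1 p by (simp add: of_nat_diff)
  ultimately show "p - 1 \<notin> Des (Suc n) (w \<circ> insertion p s n)"
    by (simp only: Des_def) auto
next
  assume s1: "s = - 1"
  show "p \<notin> Des (Suc n) (w \<circ> insertion p s n)"
  proof
    assume d: "p \<in> Des (Suc n) (w \<circ> insertion p s n)"
    hence "p \<le> n" by (simp add: Des_def)
    hence "\<bar>(w \<circ> insertion p s n) (int p + 1)\<bar> \<le> int n"
      by (intro comp_insertion_bound) auto
    moreover have "(w \<circ> insertion p s n) (int p) = - int n - 1"
      using comp_insertion_at s1 by simp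
    ultimately show False using d by (simp only: Des_def) auto
  qed
qed

text \<open>Pairs that avoid p and -p are pairs of \<open>w\<close>, with \<open>R\<close>
  transported to \<open>R'\<close>. A maximum at p exceeds every later entry. A minimum at p is
  inverted with every i before it, and its mirror image, a maximum at -p, contributes the pairs (-p,
  j).\<close>

lemma card_inversions_insertion:
  assumes R: "\<And>i j. \<bar>i\<bar> < j \<Longrightarrow> j \<le> int (Suc n) \<Longrightarrow> \<bar>i\<bar> \<noteq> int p \<Longrightarrow> j \<noteq> int p \<Longrightarrow>
    R' (insertion p s n i) (insertion p s n j) \<longleftrightarrow> R i j"
  shows "card (inversions R (Suc n) (w \<circ> insertion p s n)) = card (inversions R' n w) +
    (if s = 1 then card {j \<in> {int p<..int (Suc n)}. R (int p) j}
     else card {i. \<bar>i\<bar> < int p \<and> R i (int p)} + card {j \<in> {int p<..int (Suc n)}. R (- int p) j})"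
proof -
  let ?c = "insertion p s n"
  let ?u = "w \<circ> ?c"
  \<comment> \<open>The inverse of \<open>insertion\<close> off p and -p: it reopens the
    gap.\<close>
  define d where "d = (\<lambda>k. if k \<ge> int p then k + 1 else if k \<le> - int p then k - 1 else k)"
  define A where "A = {(i, j) \<in> inversions R (Suc n) ?u. \<bar>i\<bar> \<noteq> int p \<and> j \<noteq> int p}"
  define B where "B = {(i, j) \<in> inversions R (Suc n) ?u. \<bar>i\<bar> = int p \<or> j = int p}"
  have cd: "?c (d k) = k" "\<bar>d k\<bar> \<noteq> int p" if "\<bar>k\<bar> \<le> int n" for k
    using that p by (auto simp: insertion_def d_def)
  have dc: "d (?c i) = i" if "\<bar>i\<bar> \<le> int (Suc n)" "\<bar>i\<bar> \<noteq> int p" for i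
    using that p by (auto simp: insertion_def d_def)
  have clt: "\<bar>?c i\<bar> < ?c j" "?c j \<le> int n"
    if "\<bar>i\<bar> < j" "j \<le> int (Suc n)" "\<bar>i\<bar> \<noteq> int p" "j \<noteq> int p" for i j
  proof -
    have "?c (- j) < ?c i" "?c i < ?c j" using that by (auto intro!: insertion_less)
    thus "\<bar>?c i\<bar> < ?c j" by (auto simp: insertion_minus)
    show "?c j \<le> int n" using insertion_bound[of j] that by auto
  qed
  have dlt: "\<bar>d i\<bar> < d j" "d j \<le> int (Suc n)" if "\<bar>i\<bar> < j" "j \<le> int n" for i j
    using that p by (auto simp: d_def)
  have "bij_betw (\<lambda>(i, j). (?c i, ?c j)) A (inversions R' n w)"
  proof (rule bij_betw_byWitness[where f' = "\<lambda>(i, j). (d i, d j)"])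
    show "\<forall>x\<in>A. (case case x of (i, j) \<Rightarrow> (?c i, ?c j) of (i, j) \<Rightarrow> (d i, d j)) = x"
      by (auto simp: A_def inversions_def dc)
    show "\<forall>x\<in>inversions R' n w. (case case x of (i, j) \<Rightarrow> (d i, d j) of (i, j) \<Rightarrow> (?c i, ?c j)) = x"
      by (auto simp: inversions_def cd)
    show "(\<lambda>(i, j). (?c i, ?c j)) ` A \<subseteq> inversions R' n w"
      using clt R by (auto simp: A_def inversions_def)
    show "(\<lambda>(i, j). (d i, d j)) ` inversions R' n w \<subseteq> A"
    proof clarify
      fix i j assume ij: "(i, j) \<in> inversions R' n w"
      hence "\<bar>i\<bar> < j" "j \<le> int n" "R' i j" "w j < w i" by (auto simp: inversions_def)
      thus "(d i, d j) \<in> A"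
        using dlt[of i j] cd[of i] cd[of j] R[of "d i" "d j"] by (auto simp: A_def inversions_def)
    qed
  qed
  hence cardA: "card A = card (inversions R' n w)" by (rule bij_betw_same_card)
  have split: "inversions R (Suc n) ?u = A \<union> B" and disj: "A \<inter> B = {}"
    by (auto simp: A_def B_def)
  hence fin: "finite A" "finite B"
    using finite_inversions[of R "Suc n" ?u] by auto
  have at: "?u (int p) = s * (int n + 1)" "?u (- int p) = - s * (int n + 1)"
    by (rule comp_insertion_at)+
  have bound: "\<bar>?u i\<bar> \<le> int n" if "\<bar>i\<bar> \<le> int (Suc n)" "\<bar>i\<bar> \<noteq> int p" for i
    using comp_insertion_bound[OF that] .
  have inv: "(i, j) \<in> B \<longleftrightarrow> \<bar>i\<bar> < j \<and> j \<le> int (Suc n) \<and> R i j \<and> (if s = 1 then i = int p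
      else j = int p \<or> i = - int p)" for i j
  proof (cases "\<bar>i\<bar> < j \<and> j \<le> int (Suc n)")
    case True
    consider "j = int p" | "i = int p" | "i = - int p" | "\<bar>i\<bar> \<noteq> int p" "j \<noteq> int p"
      by linarith
    thus ?thesis
    proof cases
      case 1
      hence "\<bar>?u i\<bar> \<le> int n" using True p by (intro bound) auto
      thus ?thesis using True 1 s at by (auto simp: B_def inversions_def simp del: o_apply)
    next
      case 2
      hence "\<bar>?u j\<bar> \<le> int n" using True p by (intro bound) auto
      thus ?thesis using True 2 s at by (auto simp: B_def inversions_def simp del: o_apply)
    next
      case 3
      hence "\<bar>?u j\<bar> \<le> int n" using True p by (intro bound) auto
      thus ?thesis using True 3 s at p by (auto simp: B_def inversions_def simp del: o_apply)
    next
      case 4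
      thus ?thesis using True by (auto simp: B_def)
    qed
  qed (auto simp: B_def inversions_def)
  have cardB: "card B = (if s = 1 then card {j \<in> {int p<..int (Suc n)}. R (int p) j}
     else card {i. \<bar>i\<bar> < int p \<and> R i (int p)} + card {j \<in> {int p<..int (Suc n)}. R (- int p) j})"
  proof (cases "s = 1")
    case True
    have "B = Pair (int p) ` {j \<in> {int p<..int (Suc n)}. R (int p) j}"
      using inv True by (auto simp: image_iff)
    thus ?thesis using True by (simp add: card_image inj_on_def)
  next
    case False
    let ?M = "{i. \<bar>i\<bar> < int p \<and> R i (int p)}" and ?N = "{j \<in> {int p<..int (Suc n)}. R (- int p) j}"
    have "B = (\<lambda>i. (i, int p)) ` ?M \<union> Pair (- int p) ` ?N"
      using inv False p by (auto simp: image_iff)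
    moreover have "(\<lambda>i. (i, int p)) ` ?M \<inter> Pair (- int p) ` ?N = {}" by auto
    moreover have "finite ?M" by (rule finite_subset[of _ "{- int p..int p}"]) auto
    moreover have "finite ?N" by (rule finite_subset[of _ "{int p..int (Suc n)}"]) auto
    ultimately have "card B = card ((\<lambda>i. (i, int p)) ` ?M) + card (Pair (- int p) ` ?N)"
      by (simp only: card_Un_disjoint finite_imageI)
    thus ?thesis using False by (simp add: card_image inj_on_def)
  qed
  show ?thesis
    unfolding split card_Un_disjoint[OF fin disj] cardA cardB ..
qed

lemma neg_comp_insertion: "neg (Suc n) (w \<circ> insertion p s n) = neg n w + (if s = 1 then 0 else 1)"
proof -
  let ?c = "insertion p s n"
  let ?u = "w \<circ> ?c"
  let ?A = "{i \<in> {1..int (Suc n)}. i \<noteq> int p \<and> ?u i < 0}"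
  have "bij_betw ?c ?A {i \<in> {1..int n}. w i < 0}"
    by (rule bij_betw_byWitness[where f' = "\<lambda>k. if k \<ge> int p then k + 1 else k"])
       (use p in \<open>auto simp: insertion_def\<close>)
  hence cardA: "card ?A = card {i \<in> {1..int n}. w i < 0}" by (rule bij_betw_same_card)
  have fin: "finite ?A" by (rule finite_Collect_conjI) simp
  have at: "?u (int p) = s * (int n + 1)" by (rule comp_insertion_at)
  have "{i \<in> {1..int (Suc n)}. ?u i < 0} = (if s = 1 then ?A else insert (int p) ?A)"
    using at p s by (auto simp del: o_apply)
  thus ?thesis using fin unfolding neg_def cardA[symmetric] by auto
qed

text \<open>Behind p there are n + 1 - p positions. A negative top value also meets the 2 p - 2
  nonzero i with |i| < p, and \<open>neg\<close> adds one more.\<close>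

lemma signed_length_comp_insertion:
  "signed_length (Suc n) (w \<circ> insertion p s n) =
    signed_length n w + (Suc n - p) + (if s = 1 then 0 else 2 * p - 1)"
proof -
  have "insertion p s n i \<noteq> 0 \<longleftrightarrow> i \<noteq> 0" for i
    using hyp_eq_0_iff[OF insertion_hyp] by simp
  note inv = card_inversions_insertion[of "\<lambda>i j. i \<noteq> 0" "\<lambda>i j. i \<noteq> 0", OF this]
  have 1: "{j \<in> {int p<..int (Suc n)}. int p \<noteq> 0} = {int p<..int (Suc n)}"
    "{j \<in> {int p<..int (Suc n)}. - int p \<noteq> 0} = {int p<..int (Suc n)}" using p by auto
  have "{i. \<bar>i\<bar> < int p \<and> i \<noteq> 0} = {- int p<..<int p} - {0}" by auto
  hence 2: "card {i. \<bar>i\<bar> < int p \<and> i \<noteq> 0} = 2 * p - 2"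
    using p by (simp add: nat_eq_iff)
  show ?thesis
    unfolding signed_length_def inv neg_comp_insertion 1 2 using p by auto
qed

end

lemma insertion_surj:
  assumes u: "u \<in> hyperoctahedral (Suc n)" and top: "u (int p) = s * (int n + 1)"
  shows "u \<circ> inv (insertion p s n) \<in> hyperoctahedral n"
    "u \<circ> inv (insertion p s n) \<circ> insertion p s n = u"
proof -
  note c = insertion_hyp
  have "insertion p s n (s * int p) = int n + 1"
    using s p by (auto simp: insertion_def)
  hence "inv (insertion p s n) (int n + 1) = s * int p"
    by (metis hyp_inv_f[OF c])
  moreover have "u (s * int p) = int n + 1"
    using s top hyp_minus[OF u] by auto
  ultimately have "(u \<circ> inv (insertion p s n)) (int (Suc n)) = int (Suc n)"
    by (simp add: add.commute)
  thus "u \<circ> inv (insertion p s n) \<in> hyperoctahedral n"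
    by (intro hyp_restrict[OF hyp_comp[OF u hyp_inv[OF c]]]) auto
  show "u \<circ> inv (insertion p s n) \<circ> insertion p s n = u"
    by (simp add: fun_eq_iff hyp_inv_f[OF c])
qed

lemma bij_betw_insertion:
  assumes Des: "\<And>w. w \<in> hyperoctahedral n \<Longrightarrow>
    Des (Suc n) (w \<circ> insertion p s n) \<subseteq> {b} \<longleftrightarrow> Des n w \<subseteq> {b'}"
  shows "bij_betw (\<lambda>w. w \<circ> insertion p s n) (maximal_quotient n b')
    {u \<in> maximal_quotient (Suc n) b. u (int p) = s * (int n + 1)}"
proof (rule bij_betw_byWitness[where f' = "\<lambda>u. u \<circ> inv (insertion p s n)"])
  note c = insertion_hyp
  show "\<forall>w\<in>maximal_quotient n b'. w \<circ> insertion p s n \<circ> inv (insertion p s n) = w"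
    by (simp add: fun_eq_iff hyp_f_inv[OF c])
  show "\<forall>u\<in>{u \<in> maximal_quotient (Suc n) b. u (int p) = s * (int n + 1)}.
      u \<circ> inv (insertion p s n) \<circ> insertion p s n = u"
    by (simp add: fun_eq_iff hyp_inv_f[OF c])
  show "(\<lambda>w. w \<circ> insertion p s n) ` maximal_quotient n b'
      \<subseteq> {u \<in> maximal_quotient (Suc n) b. u (int p) = s * (int n + 1)}"
  proof clarify
    fix w assume w: "w \<in> maximal_quotient n b'"
    hence h: "w \<in> hyperoctahedral n" by (rule maximal_quotient_hyp)
    have "w \<circ> insertion p s n \<in> hyperoctahedral (Suc n)"
      by (intro hyp_comp[OF hyp_mono[OF h]] c) simp
    thus "w \<circ> insertion p s n \<in> maximal_quotient (Suc n) b \<and>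
        (w \<circ> insertion p s n) (int p) = s * (int n + 1)"
      using w Des[OF h] comp_insertion_at(1)[OF h] unfolding maximal_quotient_def by blast
  qed
  show "(\<lambda>u. u \<circ> inv (insertion p s n)) ` {u \<in> maximal_quotient (Suc n) b. u (int p) = s * (int n + 1)}
      \<subseteq> maximal_quotient n b'"
  proof clarify
    fix u assume u: "u \<in> maximal_quotient (Suc n) b" "u (int p) = s * (int n + 1)"
    note surj = insertion_surj[OF maximal_quotient_hyp[OF u(1)] u(2)]
    have "Des (Suc n) (u \<circ> inv (insertion p s n) \<circ> insertion p s n) \<subseteq> {b}"
      unfolding surj(2) using u(1) by (simp add: maximal_quotient_def)
    thus "u \<circ> inv (insertion p s n) \<in> maximal_quotient n b'"
      using Des[OF surj(1)] surj(1) unfolding maximal_quotient_def by blast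
  qed
qed

end

text \<open>Positions 0..b and b + 1..n + 1 form two increasing runs. The value n + 1 must end a
  run; the value -(n + 1) at a positive position must begin one, and the first run begins at
  position 0.\<close>

lemma maximal_quotient_top:
  assumes u: "u \<in> maximal_quotient (Suc n) b" and b: "b \<le> n"
  shows "u (int (Suc n)) = int n + 1 \<or> 0 < b \<and> u (int b) = int n + 1 \<or> u (int (Suc b)) = - (int n + 1)"
proof -
  have h: "u \<in> hyperoctahedral (Suc n)" using u by (rule maximal_quotient_hyp)
  have nd: "u (int i) < u (int i + 1)" if "i < Suc n" "i \<noteq> b" for i
    using not_Des[OF h that(1)] u that by (auto simp: maximal_quotient_def)
  have ub: "\<bar>u i\<bar> \<le> int n + 1" if "\<bar>i\<bar> \<le> int n + 1" for i
    using hyp_abs_le_iff[OF h, of i] that by simp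
  define q where "q = inv u (int n + 1)"
  have uq: "u q = int n + 1" by (simp add: q_def hyp_f_inv[OF h])
  have q: "\<bar>q\<bar> \<le> int n + 1" using hyp_abs_le_iff[OF h, of q] uq by simp
  have "q \<noteq> 0" using uq hyp_0[OF h] by auto
  then consider "q > 0" | "q < 0" by linarith
  thus ?thesis
  proof cases
    case 1
    then obtain i where i: "q = int i" "0 < i" using pos_int_cases by auto
    have "i = Suc n \<or> i = b"
    proof (rule ccontr)
      assume "\<not> ?thesis"
      hence "i < Suc n" "i \<noteq> b" using q i by auto
      from nd[OF this] show False using ub[of "int i + 1"] uq i \<open>i < Suc n\<close> by simp
    qed
    thus ?thesis using uq i by auto
  next
    case 2
    then obtain i where i: "q = - int (Suc i)"
      by (metis int_cases not_less_iff_gr_or_eq of_nat_less_0_iff)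
    have top: "u (int (Suc i)) = - (int n + 1)"
      using uq hyp_minus[OF h, of "int (Suc i)"] i by simp
    have "i = b"
    proof (rule ccontr)
      assume "i \<noteq> b"
      moreover have "i < Suc n" using q i by auto
      ultimately show False using nd[of i] ub[of "int i"] top by (simp add: add.commute)
    qed
    thus ?thesis using top by simp
  qed
qed

lemma maximal_quotient_fixing_top:
  assumes b: "b \<le> n"
  shows "{u \<in> maximal_quotient (Suc n) b. u (int (Suc n)) = int n + 1} = maximal_quotient n b"
proof -
  have Des_eq: "Des (Suc n) u = Des n u" if "u \<in> hyperoctahedral n" for u
  proof -
    have "u (int n) \<le> int n" using hyp_abs_le_iff[OF that, of "int n"] by simp
    moreover have "u (int n + 1) = int n + 1" using hyp_fix[OF that] by simp
    ultimately show ?thesis by (auto simp: Des_def less_Suc_eq)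
  qed
  have "u \<in> hyperoctahedral n" if "u \<in> hyperoctahedral (Suc n)" "u (int (Suc n)) = int n + 1" for u
    using that by (intro hyp_restrict[OF that(1)]) auto
  moreover have "u \<in> hyperoctahedral (Suc n)" "u (int (Suc n)) = int n + 1"
    if "u \<in> hyperoctahedral n" for u
    using hyp_mono[OF that, of "Suc n"] hyp_fix[OF that, of "int (Suc n)"] by auto
  ultimately show ?thesis
    using Des_eq unfolding maximal_quotient_def by blast
qed

text \<open>One summand for each place of the top value. Removing it from the end of the first block
  shortens that block, hence b - 1; removing it from either end of the second block leaves
  b.\<close>

lemma sum_maximal_quotient_Suc:
  assumes b: "b \<le> n"
  shows "sum f (maximal_quotient (Suc n) b) = sum f (maximal_quotient n b) +
    (if b = 0 then 0 else \<Sum>w\<in>maximal_quotient n (b - 1). f (w \<circ> insertion b 1 n)) +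
    (\<Sum>w\<in>maximal_quotient n b. f (w \<circ> insertion (Suc b) (- 1) n))"
proof -
  let ?Q = "maximal_quotient (Suc n) b"
  let ?A = "{u \<in> ?Q. u (int (Suc n)) = int n + 1}"
  let ?C = "{u \<in> ?Q. 0 < b \<and> u (int b) = int n + 1}"
  let ?N = "{u \<in> ?Q. u (int (Suc b)) = - (int n + 1)}"
  have Q: "?Q = ?A \<union> ?C \<union> ?N"
    using maximal_quotient_top[OF _ b] by blast
  have "int (Suc n) = int b" if "u \<in> ?Q" "u (int (Suc n)) = int n + 1" "u (int b) = int n + 1" for u
    using hyp_eq_iff[OF maximal_quotient_hyp[OF that(1)], of "int (Suc n)" "int b"] that by simp
  hence "?A \<inter> ?C = {}"
    using b by fastforce
  moreover have "(?A \<union> ?C) \<inter> ?N = {}"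
  proof -
    have False if "u \<in> ?Q" "u i = int n + 1" "u (int (Suc b)) = - (int n + 1)" "i \<ge> 0" for u i
    proof -
      have "u i = - u (int (Suc b))" using that by simp
      hence "i = - int (Suc b)" using hyp_eq_minus_iff[OF maximal_quotient_hyp[OF that(1)]] by blast
      thus False using that by simp
    qed
    from this[of _ "int (Suc n)"] this[of _ "int b"] show ?thesis by (auto simp del: of_nat_Suc)
  qed
  moreover have "finite ?A" "finite ?C" "finite ?N"
    by (rule finite_Collect_conjI; simp)+
  ultimately have "sum f ?Q = sum f ?A + sum f ?C + sum f ?N"
    by (subst Q) (simp only: sum.union_disjoint finite_Un)
  also have "sum f ?A = sum f (maximal_quotient n b)"
    by (simp only: maximal_quotient_fixing_top[OF b])
  also have "sum f ?C = (if b = 0 then 0 else \<Sum>w\<in>maximal_quotient n (b - 1). f (w \<circ> insertion b 1 n))"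
  proof (cases "b = 0")
    case True
    thus ?thesis by simp
  next
    case False
    have "bij_betw (\<lambda>w. w \<circ> insertion b 1 n) (maximal_quotient n (b - 1))
      {u \<in> maximal_quotient (Suc n) b. u (int b) = 1 * (int n + 1)}"
    proof (rule bij_betw_insertion)
      fix w assume w: "w \<in> hyperoctahedral n"
      have b': "0 < b" "b \<le> Suc n" using False b by auto
      note D = Des_comp_insertion[OF b' _ w, of 1]
      have top: "b - 1 \<notin> Des (Suc n) (w \<circ> insertion b 1 n)"
        by (rule Des_comp_insertion_top(1)[OF b' _ w]) auto
      show "Des (Suc n) (w \<circ> insertion b 1 n) \<subseteq> {b} \<longleftrightarrow> Des n w \<subseteq> {b - 1}" (is "?l \<longleftrightarrow> ?r")
      proof
        assume l: ?l
        show ?r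
        proof
          fix i assume i: "i \<in> Des n w"
          show "i \<in> {b - 1}"
          proof (rule ccontr)
            assume "i \<notin> {b - 1}"
            hence "Suc i < b \<or> b \<le> i" by auto
            thus False using D[of i] i l by auto
          qed
        qed
      next
        assume r: ?r
        show ?l
        proof
          fix i assume i: "i \<in> Des (Suc n) (w \<circ> insertion b 1 n)"
          show "i \<in> {b}"
          proof (rule ccontr)
            assume "i \<notin> {b}"
            moreover have "i \<noteq> b - 1" using i top by blast
            ultimately consider "Suc i < b" | j where "i = Suc j" "b \<le> j"
              by (cases i) force+
            thus False
            proof cases
              case 1
              thus False using D(1)[of i] i r by auto
            next
              case 2
              thus False using D(2)[of j] i r b' by auto
            qed
          qed
        qed
      qed
    qed (use False b in auto)
    from sum.reindex_bij_betw[OF this, of f] False show ?thesis by simp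
  qed
  also have "sum f ?N = (\<Sum>w\<in>maximal_quotient n b. f (w \<circ> insertion (Suc b) (- 1) n))"
  proof -
    have "bij_betw (\<lambda>w. w \<circ> insertion (Suc b) (- 1) n) (maximal_quotient n b)
      {u \<in> maximal_quotient (Suc n) b. u (int (Suc b)) = (- 1) * (int n + 1)}"
    proof (rule bij_betw_insertion)
      fix w assume w: "w \<in> hyperoctahedral n"
      have b': "0 < Suc b" "Suc b \<le> Suc n" using b by auto
      note D = Des_comp_insertion[OF b' _ w, of "- 1"]
      have top: "Suc b \<notin> Des (Suc n) (w \<circ> insertion (Suc b) (- 1) n)"
        by (rule Des_comp_insertion_top(2)[OF b' _ w]) auto
      show "Des (Suc n) (w \<circ> insertion (Suc b) (- 1) n) \<subseteq> {b} \<longleftrightarrow> Des n w \<subseteq> {b}" (is "?l \<longleftrightarrow> ?r")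
      proof
        assume l: ?l
        show ?r
        proof
          fix i assume i: "i \<in> Des n w"
          show "i \<in> {b}"
          proof (rule ccontr)
            assume "i \<notin> {b}"
            hence "Suc i < Suc b \<or> Suc b \<le> i" by auto
            thus False using D[of i] i l by auto
          qed
        qed
      next
        assume r: ?r
        show ?l
        proof
          fix i assume i: "i \<in> Des (Suc n) (w \<circ> insertion (Suc b) (- 1) n)"
          show "i \<in> {b}"
          proof (rule ccontr)
            assume "i \<notin> {b}"
            moreover have "i \<noteq> Suc b" using i top by blast
            ultimately consider "Suc i < Suc b" | j where "i = Suc j" "Suc b \<le> j"
              by (cases i) force+
            thus False
            proof cases
              case 1
              thus False using D(1)[of i] i r by auto
            next
              case 2
              thus False using D(2)[of j] i r by auto
            qed
          qed
        qed
      qed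
    qed (use b in auto)
    from sum.reindex_bij_betw[OF this, of f] show ?thesis by simp
  qed
  finally show ?thesis .
qed

lemma maximal_quotient_self: "maximal_quotient n n = {id}"
proof -
  have "Des n u = {}" if "Des n u \<subseteq> {n}" for u
    using that by (auto simp: Des_def)
  thus ?thesis using strict_mono_imp_id by (auto simp: maximal_quotient_def Des_def)
qed

text \<open>
  Deleting the top value from a pair of blocks shifts the positions of the second block relative
  to those of the first by one; the offset \<open>d\<close> keeps track of the resulting change of parity.
\<close>

definition offset_parity :: "nat \<Rightarrow> nat \<Rightarrow> int \<Rightarrow> int \<Rightarrow> bool" where
  "offset_parity d b i j \<longleftrightarrow> odd (i + j + (if \<bar>i\<bar> \<le> int b \<and> int b < j then int d else 0))"

definition offset_weight :: "nat \<Rightarrow> nat \<Rightarrow> 'a :: comm_ring_1 \<Rightarrow> nat \<Rightarrow> (int \<Rightarrow> int) \<Rightarrow> 'a" where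
  "offset_weight d b Y n w =
    (- 1) ^ signed_length n w * Y ^ card (inversions (offset_parity d b) n w)"

definition offset_sum :: "nat \<Rightarrow> 'a :: comm_ring_1 \<Rightarrow> nat \<Rightarrow> nat \<Rightarrow> 'a" where
  "offset_sum d Y b m = (\<Sum>u\<in>maximal_quotient (b + m) b. offset_weight d b Y (b + m) u)"

lemma offset_sum_0: "offset_sum 0 Y b m = quotient_sum (odd_weight Y) (b + m) b"
proof -
  have "offset_parity 0 b = (\<lambda>i j. odd (i + j))" by (intro ext) (simp add: offset_parity_def)
  thus ?thesis
    by (simp add: offset_sum_def quotient_sum_def offset_weight_def odd_weight_def
        parity_inversions_def)
qed

lemma offset_sum_2: "offset_sum (Suc (Suc 0)) Y b m = offset_sum 0 Y b m"
proof -
  have "offset_parity (Suc (Suc 0)) b = offset_parity 0 b"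
    by (intro ext) (simp add: offset_parity_def)
  thus ?thesis by (simp add: offset_sum_def offset_weight_def)
qed

lemma odd_weight_id [simp]: "odd_weight Y n id = 1"
  and neg_weight_id [simp]: "neg_weight Y n id = 1"
  and offset_weight_id [simp]: "offset_weight d b Y n id = 1"
proof -
  have inv: "inversions R n id = {}" for R by (auto simp: inversions_def)
  have "{i \<in> {1..int n}. id i < 0} = {}" by auto
  hence "neg n id = 0" unfolding neg_def by (simp only: card.empty)
  thus "odd_weight Y n id = 1" "neg_weight Y n id = 1" "offset_weight d b Y n id = 1"
    by (simp_all add: odd_weight_def neg_weight_def offset_weight_def parity_inversions_def inv)
qed

lemma offset_sum_self: "offset_sum d Y b 0 = 1"
  by (simp add: offset_sum_def maximal_quotient_self)

lemma card_odd_above: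
  "card {j \<in> {int p<..int p + int m}. odd (int p + j)} = (m + 1) div 2"
  "card {j \<in> {int p<..int p + int m}. even (int p + j)} = m div 2"
proof (induction m)
  case (Suc m)
  let ?J = "\<lambda>P m. {j \<in> {int p<..int p + int m}. P (int p + j)}"
  have fin: "finite (?J P k)" for P k by (rule finite_Collect_conjI) simp
  have ins: "?J P (Suc m) = (if P (int p + (int p + int m + 1))
      then insert (int p + int m + 1) (?J P m) else ?J P m)" for P :: "int \<Rightarrow> bool"
  proof -
    have "{int p<..int p + int (Suc m)} = insert (int p + int m + 1) {int p<..int p + int m}"
      by auto
    thus ?thesis by auto
  qed
  have par: "odd (int p + (int p + int m + 1)) \<longleftrightarrow> even m"
    and par': "even (int p + (int p + int m + 1)) \<longleftrightarrow> \<not> even m" by simp_all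
  show "card (?J odd (Suc m)) = (Suc m + 1) div 2"
    using Suc.IH(1) fin[where P = "\<lambda>x. odd x"] unfolding ins[where P = "\<lambda>x. odd x"] par
    by (cases "even m") (simp_all only: if_True if_False, simp_all)
  show "card (?J even (Suc m)) = Suc m div 2"
    using Suc.IH(2) fin[where P = "\<lambda>x. even x"] unfolding ins[where P = "\<lambda>x. even x"] par'
    by (cases "even m") (simp_all only: if_True if_False, simp_all)
qed simp_all

lemma card_even_symmetric:
  "card {i. \<bar>i\<bar> < int (Suc b) \<and> even (i + int b)} = Suc b"
  "card {i. \<bar>i\<bar> < int (Suc b) \<and> odd (i + int b)} = b"
proof -
  have "{i. \<bar>i\<bar> < int (Suc b) \<and> even (i + int b)} = (\<lambda>k. 2 * int k - int b) ` {..b}" (is "?l = ?r")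
  proof (intro subset_antisym subsetI)
    fix i assume i: "i \<in> ?l"
    hence "even (i + int b)" by blast
    then obtain k where k: "i + int b = 2 * k" by (rule evenE)
    hence "i = 2 * int (nat k) - int b" "nat k \<in> {..b}" using i by auto
    thus "i \<in> ?r" by blast
  qed auto
  thus "card ?l = Suc b" by (simp add: card_image inj_on_def)
  have "{i. \<bar>i\<bar> < int (Suc b) \<and> odd (i + int b)} = (\<lambda>k. 2 * int k + 1 - int b) ` {..<b}" (is "?l = ?r")
  proof (intro subset_antisym subsetI)
    fix i assume i: "i \<in> ?l"
    hence "odd (i + int b)" by blast
    then obtain k where k: "i + int b = 2 * k + 1" by (rule oddE)
    hence "i = 2 * int (nat k) + 1 - int b" "nat k \<in> {..<b}" using i by auto
    thus "i \<in> ?r" by blast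
  qed auto
  thus "card ?l = b" by (simp add: card_image inj_on_def)
qed

text \<open>Taking position b + 1 out moves the second block by one and leaves the first in place.
  For mixed pairs this changes the parity of i + j, which the larger offset repairs; inside the
  second block, also for negative i, the sum changes by an even number.\<close>

lemma offset_parity_insertion_1:
  assumes "\<bar>i\<bar> < j" "j \<le> int (Suc n)" "\<bar>i\<bar> \<noteq> int (Suc b)" "j \<noteq> int (Suc b)"
  shows "offset_parity (Suc d) b (insertion (Suc b) 1 n i) (insertion (Suc b) 1 n j) \<longleftrightarrow>
    offset_parity d (Suc b) i j"
proof -
  consider "j < int (Suc b)" | "j > int (Suc b)" "i < - int (Suc b)" | "j > int (Suc b)" "i > int (Suc b)"
    | "j > int (Suc b)" "\<bar>i\<bar> < int (Suc b)"
    using assms by linarith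
  thus ?thesis
  proof cases
    case 1
    hence "insertion (Suc b) 1 n i = i" "insertion (Suc b) 1 n j = j"
      using assms by (auto simp: insertion_def)
    thus ?thesis using 1 assms by (simp add: offset_parity_def)
  next
    case 2
    hence c: "insertion (Suc b) 1 n i = i + 1" "insertion (Suc b) 1 n j = j - 1"
      using assms by (auto simp: insertion_def)
    show ?thesis unfolding c using 2 assms by (simp add: offset_parity_def)
  next
    case 3
    hence c: "insertion (Suc b) 1 n i = i - 1" "insertion (Suc b) 1 n j = j - 1"
      using assms by (auto simp: insertion_def)
    show ?thesis unfolding c using 3 assms by (simp add: offset_parity_def)
  next
    case 4
    hence c: "insertion (Suc b) 1 n i = i" "insertion (Suc b) 1 n j = j - 1"
      using assms by (auto simp: insertion_def)
    show ?thesis unfolding c using 4 assms by (simp add: offset_parity_def) blast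
  qed
qed

lemma offset_parity_insertion_minus_1:
  assumes "\<bar>i\<bar> < j" "j \<le> int (Suc n)" "\<bar>i\<bar> \<noteq> int (Suc b)" "j \<noteq> int (Suc b)"
  shows "offset_parity (Suc d) b (insertion (Suc b) (- 1) n i) (insertion (Suc b) (- 1) n j) \<longleftrightarrow>
    offset_parity d b i j"
proof -
  consider "j < int (Suc b)" | "j > int (Suc b)" "i < - int (Suc b)" | "j > int (Suc b)" "i > int (Suc b)"
    | "j > int (Suc b)" "\<bar>i\<bar> < int (Suc b)"
    using assms by linarith
  thus ?thesis
  proof cases
    case 1
    hence "insertion (Suc b) (- 1) n i = i" "insertion (Suc b) (- 1) n j = j"
      using assms by (auto simp: insertion_def)
    thus ?thesis using 1 assms by (simp add: offset_parity_def)
  next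
    case 2
    hence c: "insertion (Suc b) (- 1) n i = i + 1" "insertion (Suc b) (- 1) n j = j - 1"
      using assms by (auto simp: insertion_def)
    show ?thesis unfolding c using 2 assms by (simp add: offset_parity_def)
  next
    case 3
    hence c: "insertion (Suc b) (- 1) n i = i - 1" "insertion (Suc b) (- 1) n j = j - 1"
      using assms by (auto simp: insertion_def)
    show ?thesis unfolding c using 3 assms by (simp add: offset_parity_def)
  next
    case 4
    hence c: "insertion (Suc b) (- 1) n i = i" "insertion (Suc b) (- 1) n j = j - 1"
      using assms by (auto simp: insertion_def)
    show ?thesis unfolding c using 4 assms by (simp add: offset_parity_def) blast
  qed
qed

text \<open>m + 1 positions follow the inserted maximum. For even offset those at odd distance
  count, otherwise those at even distance.\<close>

lemma offset_weight_insertion_1: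
  assumes w: "w \<in> hyperoctahedral (Suc b + m)"
  shows "offset_weight d (Suc b) Y (Suc (Suc b + m)) (w \<circ> insertion (Suc b) 1 (Suc b + m)) =
    (- 1) ^ Suc m * Y ^ (if even d then (m + 2) div 2 else (m + 1) div 2) *
    offset_weight (Suc d) b Y (Suc b + m) w"
proof -
  have p: "0 < Suc b" "Suc b \<le> Suc (Suc b + m)" "1 = 1 \<or> (1 :: int) = - 1" by auto
  have J: "{j \<in> {int (Suc b)<..int (Suc (Suc b + m))}. offset_parity d (Suc b) (int (Suc b)) j} =
    (if even d then {j \<in> {int (Suc b)<..int (Suc b) + int (Suc m)}. odd (int (Suc b) + j)}
     else {j \<in> {int (Suc b)<..int (Suc b) + int (Suc m)}. even (int (Suc b) + j)})"
    by (auto simp: offset_parity_def)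
  have inv: "card (inversions (offset_parity d (Suc b)) (Suc (Suc b + m))
        (w \<circ> insertion (Suc b) 1 (Suc b + m))) =
      card (inversions (offset_parity (Suc d) b) (Suc b + m) w) +
      card {j \<in> {int (Suc b)<..int (Suc (Suc b + m))}. offset_parity d (Suc b) (int (Suc b)) j}"
    by (rule card_inversions_insertion[OF p w, unfolded if_P[OF refl]],
        rule offset_parity_insertion_1)
  show ?thesis
    unfolding offset_weight_def inv
      signed_length_comp_insertion[OF p w] J
    by (simp add: card_odd_above[of "Suc b" "Suc m", simplified] power_add mult_ac)
qed

text \<open>Among the i with |i| \<le> b, b + 1 agree with b in parity and b do not; the offset
  decides which of them count. The pairs (-(b + 1), j) lie inside the second block, so the offset
  does not enter there.\<close>

lemma offset_weight_insertion_minus_1: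
  assumes w: "w \<in> hyperoctahedral (b + m)"
  shows "offset_weight d b Y (Suc (b + m)) (w \<circ> insertion (Suc b) (- 1) (b + m)) =
    (- 1) ^ Suc m * Y ^ (b + (m + 1) div 2 + (if even d then 1 else 0)) *
    offset_weight (Suc d) b Y (b + m) w"
proof -
  have p: "0 < Suc b" "Suc b \<le> Suc (b + m)" "- 1 = 1 \<or> (- 1 :: int) = - 1" by auto
  have J: "{j \<in> {int (Suc b)<..int (Suc (b + m))}. offset_parity d b (- int (Suc b)) j} =
    {j \<in> {int (Suc b)<..int (Suc b) + int m}. odd (int (Suc b) + j)}"
    by (auto simp: offset_parity_def)
  have I: "{i. \<bar>i\<bar> < int (Suc b) \<and> offset_parity d b i (int (Suc b))} =
    (if even d then {i. \<bar>i\<bar> < int (Suc b) \<and> even (i + int b)}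
     else {i. \<bar>i\<bar> < int (Suc b) \<and> odd (i + int b)})"
    by (auto simp: offset_parity_def)
  have sign: "(- 1 :: 'a) ^ (k + (Suc (b + m) - Suc b) + (2 * Suc b - 1)) = (- 1) ^ Suc m * (- 1) ^ k"
    for k by (simp add: power_add power_mult)
  have ne: "(- 1 :: int) \<noteq> 1" by simp
  have inv: "card (inversions (offset_parity d b) (Suc (b + m))
        (w \<circ> insertion (Suc b) (- 1) (b + m))) =
      card (inversions (offset_parity (Suc d) b) (b + m) w) +
      (card {i. \<bar>i\<bar> < int (Suc b) \<and> offset_parity d b i (int (Suc b))} +
       card {j \<in> {int (Suc b)<..int (Suc (b + m))}. offset_parity d b (- int (Suc b)) j})"
    by (rule card_inversions_insertion[OF p w, unfolded if_not_P[OF ne]],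
        rule offset_parity_insertion_minus_1)
  show ?thesis
    unfolding offset_weight_def inv
      signed_length_comp_insertion[OF p w, unfolded if_not_P[OF ne]] J I card_odd_above
    unfolding sign by (cases "even d")
      (simp_all only: if_True if_False simp_thms card_even_symmetric power_add power_one_right
        power_Suc power_0 mult_1_right mult_1_left mult_ac)
qed

text \<open>An empty first block cannot hold the top value, hence the default 0 at b = 0.\<close>

definition at_pred :: "(nat \<Rightarrow> 'a :: zero) \<Rightarrow> nat \<Rightarrow> 'a" where
  "at_pred f b = (case b of 0 \<Rightarrow> 0 | Suc b' \<Rightarrow> f b')"

lemma at_pred_simps [simp]: "at_pred f 0 = 0" "at_pred f (Suc b) = f b"
  by (simp_all add: at_pred_def)

lemma
  assumes u: "u \<in> hyperoctahedral n"
  shows inversions_Suc: "inversions R (Suc n) u = inversions R n u"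
    and neg_Suc: "neg (Suc n) u = neg n u"
    and signed_length_Suc: "signed_length (Suc n) u = signed_length n u"
proof -
  have top: "u (int (Suc n)) = int (Suc n)" by (rule hyp_fix[OF u]) simp
  have le: "u i \<le> int n" if "\<bar>i\<bar> \<le> int n" for i
    using hyp_abs_le_iff[OF u, of i] that by auto
  have "j \<le> int n" if "\<bar>i\<bar> < j" "j \<le> int (Suc n)" "u j < u i" for i j
    using that top le[of i] by (cases "j = int (Suc n)") auto
  thus inv: "inversions R (Suc n) u = inversions R n u" for R
    by (auto simp: inversions_def)
  have "{1..int (Suc n)} = insert (int (Suc n)) {1..int n}" by auto
  hence "{i \<in> {1..int (Suc n)}. u i < 0} = {i \<in> {1..int n}. u i < 0}"
    using top by auto
  thus "neg (Suc n) u = neg n u" by (simp only: neg_def)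
  thus "signed_length (Suc n) u = signed_length n u"
    by (simp add: signed_length_def inv)
qed

text \<open>Here m is the size of the second block. Removing the top value shifts nothing if it
  comes last; from the other two places its removal raises the offset.\<close>

lemma offset_sum_Suc:
  "offset_sum d Y b (Suc m) = offset_sum d Y b m +
    (- 1) ^ Suc m * Y ^ (if even d then (m + 2) div 2 else (m + 1) div 2) *
      at_pred (\<lambda>b. offset_sum (Suc d) Y b (Suc m)) b +
    (- 1) ^ Suc m * Y ^ (b + (m + 1) div 2 + (if even d then 1 else 0)) * offset_sum (Suc d) Y b m"
proof -
  have "offset_sum d Y b (Suc m) = sum (offset_weight d b Y (Suc (b + m))) (maximal_quotient (Suc (b + m)) b)"
    by (simp add: offset_sum_def)
  also have "\<dots> = sum (offset_weight d b Y (Suc (b + m))) (maximal_quotient (b + m) b) +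
    (if b = 0 then 0 else \<Sum>w\<in>maximal_quotient (b + m) (b - 1).
      offset_weight d b Y (Suc (b + m)) (w \<circ> insertion b 1 (b + m))) +
    (\<Sum>w\<in>maximal_quotient (b + m) b.
      offset_weight d b Y (Suc (b + m)) (w \<circ> insertion (Suc b) (- 1) (b + m)))"
    by (rule sum_maximal_quotient_Suc) simp
  also have "sum (offset_weight d b Y (Suc (b + m))) (maximal_quotient (b + m) b) = offset_sum d Y b m"
    unfolding offset_sum_def
  proof (intro sum.cong refl)
    fix u assume "u \<in> maximal_quotient (b + m) b"
    hence u: "u \<in> hyperoctahedral (b + m)" by (rule maximal_quotient_hyp)
    thus "offset_weight d b Y (Suc (b + m)) u = offset_weight d b Y (b + m) u"
      by (simp add: offset_weight_def signed_length_Suc inversions_Suc)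
  qed
  also have "(if b = 0 then 0 else \<Sum>w\<in>maximal_quotient (b + m) (b - 1).
      offset_weight d b Y (Suc (b + m)) (w \<circ> insertion b 1 (b + m))) =
    (- 1) ^ Suc m * Y ^ (if even d then (m + 2) div 2 else (m + 1) div 2) *
      at_pred (\<lambda>b. offset_sum (Suc d) Y b (Suc m)) b"
  proof (cases b)
    case (Suc b')
    have "(\<Sum>w\<in>maximal_quotient (Suc b' + m) b'.
        offset_weight d (Suc b') Y (Suc (Suc b' + m)) (w \<circ> insertion (Suc b') 1 (Suc b' + m))) =
      (\<Sum>w\<in>maximal_quotient (Suc b' + m) b'.
        (- 1) ^ Suc m * Y ^ (if even d then (m + 2) div 2 else (m + 1) div 2) *
        offset_weight (Suc d) b' Y (Suc b' + m) w)"
      by (intro sum.cong refl offset_weight_insertion_1 maximal_quotient_hyp)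
    thus ?thesis by (simp add: Suc offset_sum_def sum_distrib_left)
  qed simp
  also have "(\<Sum>w\<in>maximal_quotient (b + m) b.
      offset_weight d b Y (Suc (b + m)) (w \<circ> insertion (Suc b) (- 1) (b + m))) =
    (- 1) ^ Suc m * Y ^ (b + (m + 1) div 2 + (if even d then 1 else 0)) * offset_sum (Suc d) Y b m"
    unfolding offset_sum_def sum_distrib_left
    by (intro sum.cong refl offset_weight_insertion_minus_1 maximal_quotient_hyp)
  finally show ?thesis .
qed

text \<open>The top value in last position and its negative at b + 1 leave the same quotient. The
  latter costs length 2 b + m + 1 and a sign, so the two merge into one factor.\<close>

lemma neg_quotient_sum_Suc:
  "quotient_sum (neg_weight Y) (b + Suc m) b = (1 - Y ^ (2 * b + Suc m)) * quotient_sum (neg_weight Y) (b + m) b +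
    Y ^ Suc m * at_pred (\<lambda>b. quotient_sum (neg_weight Y) (b + Suc m) b) b"
proof -
  let ?f = "neg_weight Y (Suc (b + m))"
  have "quotient_sum (neg_weight Y) (b + Suc m) b = sum ?f (maximal_quotient (Suc (b + m)) b)"
    by (simp add: quotient_sum_def)
  also have "\<dots> = sum ?f (maximal_quotient (b + m) b) +
    (if b = 0 then 0 else \<Sum>w\<in>maximal_quotient (b + m) (b - 1). ?f (w \<circ> insertion b 1 (b + m))) +
    (\<Sum>w\<in>maximal_quotient (b + m) b. ?f (w \<circ> insertion (Suc b) (- 1) (b + m)))"
    by (rule sum_maximal_quotient_Suc) simp
  also have "sum ?f (maximal_quotient (b + m) b) = quotient_sum (neg_weight Y) (b + m) b"
    unfolding quotient_sum_def
    by (intro sum.cong refl)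
       (auto simp: neg_weight_def maximal_quotient_hyp signed_length_Suc neg_Suc)
  also have "(if b = 0 then 0 else \<Sum>w\<in>maximal_quotient (b + m) (b - 1). ?f (w \<circ> insertion b 1 (b + m))) =
    Y ^ Suc m * at_pred (\<lambda>b. quotient_sum (neg_weight Y) (b + Suc m) b) b"
  proof (cases b)
    case (Suc b')
    have "?f (w \<circ> insertion b 1 (b + m)) = Y ^ Suc m * neg_weight Y (b + m) w"
      if "w \<in> maximal_quotient (b + m) b'" for w
    proof -
      have p: "0 < b" "b \<le> Suc (b + m)" "1 = 1 \<or> (1 :: int) = - 1" using Suc by auto
      note w = maximal_quotient_hyp[OF that]
      show ?thesis
        unfolding neg_weight_def signed_length_comp_insertion[OF p w] neg_comp_insertion[OF p w]
        by (simp add: power_add mult_ac Suc_diff_le)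
    qed
    hence "(\<Sum>w\<in>maximal_quotient (b + m) b'. ?f (w \<circ> insertion b 1 (b + m))) =
      (\<Sum>w\<in>maximal_quotient (b + m) b'. Y ^ Suc m * neg_weight Y (b + m) w)"
      by (intro sum.cong refl)
    thus ?thesis by (simp add: Suc quotient_sum_def sum_distrib_left)
  qed simp
  also have "(\<Sum>w\<in>maximal_quotient (b + m) b. ?f (w \<circ> insertion (Suc b) (- 1) (b + m))) =
    - (Y ^ (2 * b + Suc m)) * quotient_sum (neg_weight Y) (b + m) b"
    unfolding quotient_sum_def sum_distrib_left
  proof (intro sum.cong refl)
    fix w assume "w \<in> maximal_quotient (b + m) b"
    hence w: "w \<in> hyperoctahedral (b + m)" by (rule maximal_quotient_hyp)
    have p: "0 < Suc b" "Suc b \<le> Suc (b + m)" "- 1 = 1 \<or> (- 1 :: int) = - 1" by auto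
    have "(- 1 :: int) \<noteq> 1" by simp
    note ne = if_not_P[OF this]
    have "k + (Suc (b + m) - Suc b) + (2 * Suc b - 1) = k + (2 * b + Suc m)" for k by simp
    thus "?f (w \<circ> insertion (Suc b) (- 1) (b + m)) = - (Y ^ (2 * b + Suc m)) * neg_weight Y (b + m) w"
      unfolding neg_weight_def signed_length_comp_insertion[OF p w] neg_comp_insertion[OF p w] ne
      by (simp only: power_add) (simp add: mult_ac)
  qed
  finally show ?thesis by (simp add: algebra_simps)
qed

section \<open>Quotient sums for the odd length\<close>

context
  fixes Y :: "'a :: comm_ring_1"
begin

private abbreviation "p0 \<equiv> offset_sum 0 Y"
private abbreviation "p1 \<equiv> offset_sum (Suc 0) Y"

private lemma p0_odd: "p0 b (Suc (2 * k)) = p0 b (2 * k) -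
    Y ^ Suc k * at_pred (\<lambda>b. p1 b (Suc (2 * k))) b - Y ^ (b + Suc k) * p1 b (2 * k)"
  using offset_sum_Suc[of 0 Y b "2 * k"] by simp

private lemma p0_even: "p0 b (Suc (Suc (2 * k))) = p0 b (Suc (2 * k)) +
    Y ^ Suc k * at_pred (\<lambda>b. p1 b (Suc (Suc (2 * k)))) b + Y ^ (b + Suc (Suc k)) * p1 b (Suc (2 * k))"
  using offset_sum_Suc[of 0 Y b "Suc (2 * k)"] by simp

private lemma p1_odd: "p1 b (Suc (2 * k)) = p1 b (2 * k) -
    Y ^ k * at_pred (\<lambda>b. p0 b (Suc (2 * k))) b - Y ^ (b + k) * p0 b (2 * k)"
  using offset_sum_Suc[of "Suc 0" Y b "2 * k"] by (simp add: offset_sum_2)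

private lemma p1_even: "p1 b (Suc (Suc (2 * k))) = p1 b (Suc (2 * k)) +
    Y ^ Suc k * at_pred (\<lambda>b. p0 b (Suc (Suc (2 * k)))) b + Y ^ (b + Suc k) * p0 b (Suc (2 * k))"
  using offset_sum_Suc[of "Suc 0" Y b "Suc (2 * k)"] by (simp add: offset_sum_2)

text \<open>
  A shifted second block of odd size is cancelled completely, one of even size only
  contributes a power of \<open>Y\<close>. The induction also needs how the sums depend on the first block.
\<close>

private definition shifted :: "nat \<Rightarrow> nat \<Rightarrow> bool" where
  "shifted b m \<longleftrightarrow> (if odd m then p1 b m = 0 else p1 b m = Y ^ (m div 2) * p0 b m \<and>
     (1 - Y ^ b) * p0 b m = (1 - Y ^ (b + m)) * at_pred (\<lambda>b. p0 b m) b)"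

private lemma shifted_odd: "shifted b (Suc (2 * k)) \<longleftrightarrow> p1 b (Suc (2 * k)) = 0"
  and shifted_even: "shifted b (2 * k) \<longleftrightarrow> p1 b (2 * k) = Y ^ k * p0 b (2 * k) \<and>
    (1 - Y ^ b) * p0 b (2 * k) = (1 - Y ^ (b + 2 * k)) * at_pred (\<lambda>b. p0 b (2 * k)) b"
  by (simp_all add: shifted_def)

text \<open>The shifted odd block vanishes, which removes the term with the shorter first block; the
  shifted even block supplies the \<open>Y ^ k\<close> that completes the exponent b + 2 k +
  1.\<close>

private lemma p0_odd':
  assumes "\<And>b' m'. b' + m' = b + 2 * k \<Longrightarrow> shifted b' m'"
  shows "p0 b (Suc (2 * k)) = (1 - Y ^ (b + Suc (2 * k))) * p0 b (2 * k)"
proof -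
  have "p1 b (2 * k) = Y ^ k * p0 b (2 * k)"
    using assms[of b "2 * k"] by (simp add: shifted_even)
  moreover have "at_pred (\<lambda>b. p1 b (Suc (2 * k))) b = 0"
    using assms[of "b - 1" "Suc (2 * k)"] by (cases b) (auto simp: shifted_odd)
  moreover have "Y ^ (b + Suc k) * Y ^ k = Y ^ (b + Suc (2 * k))"
    unfolding power_add[symmetric] by (simp add: mult_2 add.assoc)
  ultimately show ?thesis
    unfolding p0_odd by (simp add: left_diff_distrib mult.assoc[symmetric] del: power_Suc add_Suc_right)
qed

text \<open>Here the vanishing of the shifted odd block removes the term of the negative top value
  instead.\<close>

private lemma p0_even':
  assumes "\<And>b' m'. b' + m' = b + Suc (2 * k) \<Longrightarrow> shifted b' m'"
  shows "p0 b (Suc (Suc (2 * k))) = p0 b (Suc (2 * k)) +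
    Y ^ Suc (Suc (2 * k)) * at_pred (\<lambda>b. p0 b (Suc (Suc (2 * k)))) b"
proof -
  have "p1 b (Suc (2 * k)) = 0"
    using assms[of b "Suc (2 * k)"] by (simp add: shifted_odd)
  moreover have "at_pred (\<lambda>b. p1 b (Suc (Suc (2 * k)))) b =
      Y ^ Suc k * at_pred (\<lambda>b. p0 b (Suc (Suc (2 * k)))) b"
    using assms[of "b - 1" "2 * Suc k"] shifted_even[of _ "Suc k"] by (cases b) auto
  moreover have "Y ^ Suc k * Y ^ Suc k = Y ^ Suc (Suc (2 * k))"
    unfolding power_add[symmetric] by (simp add: mult_2)
  ultimately show ?thesis
    unfolding p0_even by (simp add: mult.assoc[symmetric] del: power_Suc)
qed

private lemma shifted: "shifted b m"
proof (induction "b + m" arbitrary: b m rule: less_induct)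
  case less
  note odd = p0_odd'[OF less.hyps]
  note even = p0_even'[OF less.hyps]
  note IH_odd = less.hyps[of _ "Suc (2 * _)", unfolded shifted_odd]
  note IH_even = less.hyps[of _ "2 * _", unfolded shifted_even]
  consider "m = 0" | k where "m = Suc (2 * k)" | k where "m = Suc (Suc (2 * k))"
    by (metis nat.exhaust oddE evenE Suc_eq_plus1 even_Suc mult_Suc_right add_2_eq_Suc)
  thus ?case
  proof cases
    case 1
    show ?thesis
      using shifted_even[of b 0] 1 by (cases b) (simp_all add: offset_sum_self)
  next
    case m: 2
    have 1: "p1 b (2 * k) = Y ^ k * p0 b (2 * k)"
      "(1 - Y ^ b) * p0 b (2 * k) = (1 - Y ^ (b + 2 * k)) * at_pred (\<lambda>b. p0 b (2 * k)) b"
      using IH_even[of b k] m by auto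
    \<comment> \<open>This is where the relation between the first blocks b and b - 1 enters. The
      terms of \<open>p1_odd\<close> now have coefficients 1, -(1 - Y ^ b) and -(Y ^ b), up to a
      common factor, and cancel.\<close>
    have e: "at_pred (\<lambda>b. p0 b (Suc (2 * k))) b = (1 - Y ^ b) * p0 b (2 * k)"
      unfolding 1(2) using odd[of "b - 1" k] m by (cases b) auto
    have "p1 b (Suc (2 * k)) = 0"
      unfolding p1_odd 1(1) e by (simp add: algebra_simps power_add)
    thus ?thesis by (simp add: m shifted_odd)
  next
    case m: 3
    have odd_b: "p0 b (Suc (2 * k)) = (1 - Y ^ (b + Suc (2 * k))) * p0 b (2 * k)"
      using odd[of b k] m by simp
    have even_b: "p0 b (Suc (Suc (2 * k))) = p0 b (Suc (2 * k)) +
        Y ^ Suc (Suc (2 * k)) * at_pred (\<lambda>b. p0 b (Suc (Suc (2 * k)))) b"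
      using even[of b k] m by simp
    have p1: "p1 b (Suc (2 * k)) = 0" using IH_odd[of b k] m by simp
    have rat: "(1 - Y ^ b) * p0 b (2 * k) = (1 - Y ^ (b + 2 * k)) * at_pred (\<lambda>b. p0 b (2 * k)) b"
      using IH_even[of b k] m by auto
    \<comment> \<open>One element moves between the blocks at total size b + m - 1. This follows
      from the first-block relation at (b, 2 k) and at (b - 1, 2 k + 2), linked by the two
      recursions.\<close>
    have exchange: "(1 - Y ^ Suc (Suc (2 * k))) * at_pred (\<lambda>b. p0 b (Suc (Suc (2 * k)))) b =
        (1 - Y ^ b) * p0 b (Suc (2 * k))"
    proof (cases b)
      case (Suc c)
      have "(1 - Y ^ c) * p0 c (2 * Suc k) = (1 - Y ^ (c + 2 * Suc k)) * at_pred (\<lambda>b. p0 b (2 * Suc k)) c"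
        using IH_even[of c "Suc k"] m Suc by simp
      hence c1: "(1 - Y ^ c) * p0 c (Suc (Suc (2 * k))) =
          (1 - Y ^ (b + Suc (2 * k))) * at_pred (\<lambda>b. p0 b (Suc (Suc (2 * k)))) c"
        using Suc by simp
      have c2: "p0 c (Suc (Suc (2 * k))) = p0 c (Suc (2 * k)) +
          Y ^ Suc (Suc (2 * k)) * at_pred (\<lambda>b. p0 b (Suc (Suc (2 * k)))) c"
        using even[of c k] m Suc by simp
      have c3: "p0 c (Suc (2 * k)) = (1 - Y ^ (b + 2 * k)) * p0 c (2 * k)"
        using odd[of c k] m Suc by simp
      let ?q = "Y ^ (b + Suc (2 * k))" and ?r = "Y ^ Suc (Suc (2 * k))"
      have "(1 - Y ^ b) * p0 b (Suc (2 * k)) = (1 - ?q) * ((1 - Y ^ b) * p0 b (2 * k))"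
        unfolding odd_b by (simp only: mult_ac)
      also have "\<dots> = (1 - ?q) * p0 c (Suc (2 * k))"
        unfolding rat c3 using Suc by simp
      also have "p0 c (Suc (2 * k)) =
          p0 c (Suc (Suc (2 * k))) - ?r * at_pred (\<lambda>b. p0 b (Suc (Suc (2 * k)))) c"
        unfolding c2 by simp
      also have "(1 - ?q) * \<dots> = (1 - ?q) * p0 c (Suc (Suc (2 * k))) -
          ?r * ((1 - ?q) * at_pred (\<lambda>b. p0 b (Suc (Suc (2 * k)))) c)"
        by (simp only: right_diff_distrib mult_ac)
      also have "\<dots> = (1 - ?q - ?r * (1 - Y ^ c)) * p0 c (Suc (Suc (2 * k)))"
        unfolding c1[symmetric] by (simp only: algebra_simps mult_1_left)
      also have "1 - ?q - ?r * (1 - Y ^ c) = 1 - ?r"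
        using Suc by (simp add: algebra_simps power_add)
      finally show ?thesis using Suc by simp
    qed simp
    have "p1 b (Suc (Suc (2 * k))) = Y ^ Suc k * p0 b (Suc (Suc (2 * k)))"
    proof -
      \<comment> \<open>The defect of the claim is a multiple of the defect of
        \<open>exchange\<close>.\<close>
      have "p1 b (Suc (Suc (2 * k))) - Y ^ Suc k * p0 b (Suc (Suc (2 * k))) =
          Y ^ Suc k * ((1 - Y ^ Suc (Suc (2 * k))) * at_pred (\<lambda>b. p0 b (Suc (Suc (2 * k)))) b -
            (1 - Y ^ b) * p0 b (Suc (2 * k)))"
        unfolding p1_even even_b p1 power_add by (simp only: algebra_simps) simp
      thus ?thesis unfolding exchange by simp
    qed
    moreover have "(1 - Y ^ b) * p0 b (Suc (Suc (2 * k))) =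
        (1 - Y ^ (b + Suc (Suc (2 * k)))) * at_pred (\<lambda>b. p0 b (Suc (Suc (2 * k)))) b"
    proof -
      have "(1 - Y ^ b) * p0 b (Suc (Suc (2 * k))) = (1 - Y ^ b) * p0 b (Suc (2 * k)) +
          (1 - Y ^ b) * Y ^ Suc (Suc (2 * k)) * at_pred (\<lambda>b. p0 b (Suc (Suc (2 * k)))) b"
        unfolding even_b by (simp only: distrib_left mult.assoc)
      also have "\<dots> = ((1 - Y ^ Suc (Suc (2 * k))) + (1 - Y ^ b) * Y ^ Suc (Suc (2 * k))) *
          at_pred (\<lambda>b. p0 b (Suc (Suc (2 * k)))) b"
        unfolding exchange[symmetric] by (simp only: distrib_right)
      also have "(1 - Y ^ Suc (Suc (2 * k))) + (1 - Y ^ b) * Y ^ Suc (Suc (2 * k)) =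
          1 - Y ^ (b + Suc (Suc (2 * k)))"
        unfolding power_add by (simp only: algebra_simps) simp
      finally show ?thesis .
    qed
    ultimately show ?thesis
      using shifted_even[of b "Suc k"] by (simp add: m)
  qed
qed

lemma odd_quotient_sum_odd:
  assumes "even m"
  shows "quotient_sum (odd_weight Y) (b + Suc m) b =
    (1 - Y ^ (b + Suc m)) * quotient_sum (odd_weight Y) (b + m) b"
proof -
  obtain k where m: "m = 2 * k" using assms by (rule evenE)
  show ?thesis
    unfolding m using p0_odd'[OF shifted, of b k] unfolding offset_sum_0 .
qed

lemma odd_quotient_sum_even:
  assumes "odd m"
  shows "quotient_sum (odd_weight Y) (b + Suc m) b = quotient_sum (odd_weight Y) (b + m) b +
    Y ^ Suc m * at_pred (\<lambda>b. quotient_sum (odd_weight Y) (b + Suc m) b) b"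
proof -
  obtain k where m: "m = Suc (2 * k)" using assms by (auto elim: oddE)
  show ?thesis
    unfolding m using p0_even'[OF shifted, of b k] unfolding offset_sum_0 .
qed

end

lemma quotient_sum_self:
  "quotient_sum (neg_weight Y) n n = 1" "quotient_sum (odd_weight Y) n n = 1"
  by (simp_all add: quotient_sum_def maximal_quotient_self)

text \<open>In \<open>f b b'\<close> the first argument carries the factor that depends on b, the
  second the summand at its predecessor. The extra term on the left is the case b = n + 1.\<close>

lemma sum_at_pred:
  fixes f :: "nat \<Rightarrow> nat \<Rightarrow> 'a :: comm_monoid_add"
  shows "(\<Sum>b\<le>n. at_pred (f b) b) + f (Suc n) n = (\<Sum>b\<le>n. f (Suc b) b)"
proof -
  have "(\<Sum>b\<le>n. at_pred (f b) b) + f (Suc n) n = (\<Sum>b\<le>Suc n. at_pred (f b) b)"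
    by simp
  also have "\<dots> = (\<Sum>b\<le>n. f (Suc b) b)"
    by (subst sum.atMost_Suc_shift) simp
  finally show ?thesis .
qed

section \<open>Moments of the corank distributions\<close>

definition moment :: "(nat \<Rightarrow> nat \<Rightarrow> 'a :: comm_ring_1) \<Rightarrow> (nat \<Rightarrow> 'a) \<Rightarrow> nat \<Rightarrow> 'a" where
  "moment \<psi> g n = (\<Sum>b\<le>n. \<psi> n b * g b)"

text \<open>To be read with u = X ^ b, v = Y ^ b and w = Y ^ (b ^ 2): the left side is
  \<open>x b * P b\<close>, and \<open>u * v = 1\<close> reduces it to the integrands of the three
  moments.\<close>

lemma neg_numerator_expand:
  fixes u v c w X :: "'a :: comm_ring_1"
  assumes "u * v = 1"
  shows "c * (u * u) * w * ((1 - c * v) * (1 - c * X * v) + c * (1 - v) * (1 - X * v)) =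
    c * (1 + c) * (w * (u * u)) - 2 * c * c * (1 + X) * (w * u) + c * (c + c * c) * X * w"
proof -
  have "c * (u * u) * w * ((1 - c * v) * (1 - c * X * v) + c * (1 - v) * (1 - X * v)) =
    c * w * ((1 + c) * (u * u) - 2 * c * (1 + X) * (u * (u * v)) + (c + c * c) * X * ((u * v) * (u * v)))"
    by (simp add: algebra_simps)
  thus ?thesis unfolding assms by (simp add: algebra_simps)
qed

lemma odd_numerator_expand:
  fixes u v c w X :: "'a :: comm_ring_1"
  assumes "u * v = 1"
  shows "c * (u * u) * w * ((1 - c * v) * (1 - c * X ^ 2 * v) + c * (1 - X * v) ^ 2) =
    c * (1 + c) * (w * (u * u)) - c * c * (1 + X) ^ 2 * (w * u) + c * (c + c * c) * X ^ 2 * w"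
proof -
  have "c * (u * u) * w * ((1 - c * v) * (1 - c * X ^ 2 * v) + c * (1 - X * v) ^ 2) =
    c * w * ((1 + c) * (u * u) - c * (1 + X) ^ 2 * (u * (u * v)) + (c + c * c) * X ^ 2 * ((u * v) * (u * v)))"
    by (simp add: algebra_simps power2_eq_square)
  thus ?thesis unfolding assms by (simp add: algebra_simps)
qed

context
  fixes X Y :: "'a :: comm_ring_1"
  assumes XY: "X * Y = 1"
begin

private lemma X_pow_Y_pow [simp]: "X ^ k * Y ^ k = 1" "Y ^ k * X ^ k = 1"
  using XY by (simp_all flip: power_mult_distrib add: mult.commute)

private abbreviation "\<phi> \<equiv> quotient_sum (neg_weight Y)"

private lemma moment_neg_Suc:
  "moment \<phi> g (Suc n) = moment \<phi> g n - Y ^ Suc n * moment \<phi> (\<lambda>b. Y ^ b * g b) n +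
    (\<Sum>b\<le>n. \<phi> n b * (Y ^ (n - b) * g (Suc b)))"
proof -
  have step: "\<phi> (Suc n) b * g b = \<phi> n b * g b - Y ^ Suc n * (\<phi> n b * (Y ^ b * g b)) +
      at_pred (\<lambda>b'. \<phi> n b' * (Y ^ (Suc n - b) * g b)) b" if "b \<le> n" for b
  proof -
    define m where "m = n - b"
    have n: "n = b + m" using that by (simp add: m_def)
    have p: "at_pred (\<lambda>b'. \<phi> n b' * (Y ^ (Suc n - b) * g b)) b =
        Y ^ Suc m * at_pred (\<lambda>b. \<phi> (b + Suc m) b) b * g b"
      by (cases b) (auto simp: n mult_ac)
    have e: "Y ^ (2 * b + Suc m) = Y ^ Suc n * Y ^ b"
      unfolding n power_add[symmetric] by (simp add: mult_2 add.commute add.left_commute)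
    have q: "\<phi> (Suc n) b = (1 - Y ^ (2 * b + Suc m)) * \<phi> n b +
        Y ^ Suc m * at_pred (\<lambda>b. \<phi> (b + Suc m) b) b"
      using neg_quotient_sum_Suc[of Y b m] by (simp add: n)
    show ?thesis unfolding p q e by (simp only: algebra_simps mult_1_left)
  qed
  have top: "moment \<phi> g (Suc n) = (\<Sum>b\<le>n. \<phi> (Suc n) b * g b) + g (Suc n)"
    by (simp add: moment_def quotient_sum_self)
  have rec: "(\<Sum>b\<le>n. \<phi> (Suc n) b * g b) = moment \<phi> g n - Y ^ Suc n * moment \<phi> (\<lambda>b. Y ^ b * g b) n +
      (\<Sum>b\<le>n. at_pred (\<lambda>b'. \<phi> n b' * (Y ^ (Suc n - b) * g b)) b)"
    unfolding moment_def sum_distrib_left sum_subtractf[symmetric] sum.distrib[symmetric]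
    by (intro sum.cong refl step) simp
  have shift: "(\<Sum>b\<le>n. at_pred (\<lambda>b'. \<phi> n b' * (Y ^ (Suc n - b) * g b)) b) + g (Suc n) =
      (\<Sum>b\<le>n. \<phi> n b * (Y ^ (n - b) * g (Suc b)))"
    using sum_at_pred[of "\<lambda>b b'. \<phi> n b' * (Y ^ (Suc n - b) * g b)" n]
    by (simp add: quotient_sum_self)
  show ?thesis unfolding top rec add.assoc shift ..
qed

private abbreviation "g k \<equiv> \<lambda>b. Y ^ (b ^ 2) * X ^ (k * b)"

text \<open>Because of n - b + (b + 1)^2 = n + 1 + b + b^2, the term with shifted index becomes a
  multiple of the other correction term in \<open>moment_neg_Suc\<close>.\<close>

private lemma g_Suc: "b \<le> n \<Longrightarrow> Y ^ (n - b) * g k (Suc b) = X ^ k * Y ^ Suc n * (Y ^ b * g k b)"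
proof -
  assume "b \<le> n"
  hence e: "n - b + (Suc b)\<^sup>2 = Suc n + b + b\<^sup>2" by (simp add: power2_eq_square)
  have "Y ^ (n - b) * g k (Suc b) = Y ^ (n - b + (Suc b)\<^sup>2) * X ^ (k * Suc b)"
    by (simp only: power_add mult.assoc)
  also have "\<dots> = X ^ k * Y ^ Suc n * (Y ^ b * g k b)"
    unfolding e by (simp add: power_add mult_ac)
  finally show ?thesis .
qed

text \<open>The coefficient \<open>X ^ k - 1\<close> vanishes for k = 0, so the total mass stays 1.
  For k > 0 the moment on the right is that of \<open>g (k - 1)\<close> by \<open>Y_g\<close>, so
  the moments follow one from another.\<close>

private lemma moment_neg_rec:
  "moment \<phi> (g k) (Suc n) = moment \<phi> (g k) n +
    (X ^ k - 1) * Y ^ Suc n * moment \<phi> (\<lambda>b. Y ^ b * g k b) n"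
proof -
  have last: "(\<Sum>b\<le>n. \<phi> n b * (Y ^ (n - b) * g k (Suc b))) =
      X ^ k * Y ^ Suc n * moment \<phi> (\<lambda>b. Y ^ b * g k b) n"
    unfolding moment_def sum_distrib_left
    by (intro sum.cong refl, subst g_Suc) (auto simp: mult_ac)
  show ?thesis
    unfolding moment_neg_Suc last by (simp add: left_diff_distrib)
qed

private lemma Y_g: "(\<lambda>b. Y ^ b * g (Suc k) b) = g k"
proof
  fix b
  have "Y ^ b * (Y ^ b\<^sup>2 * X ^ (Suc k * b)) = Y ^ b\<^sup>2 * X ^ (k * b) * (Y ^ b * X ^ b)"
    unfolding mult_Suc power_add by (simp only: mult_ac)
  thus "Y ^ b * g (Suc k) b = g k b" by simp
qed

lemma moment_neg:
  "moment \<phi> (g 0) n = 1" "moment \<phi> (g 1) n = 2 - Y ^ n"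
  "moment \<phi> (g 2) n = 1 + (X + 1) * (1 - Y ^ n) + (1 - Y ^ n) * (1 - X * Y ^ n)"
proof -
  have base: "moment \<phi> (g k) 0 = 1" for k by (simp add: moment_def quotient_sum_self)
  show m0: "moment \<phi> (g 0) n = 1" for n
    by (induction n) (simp_all only: base moment_neg_rec, simp_all)
  have XY': "X * (Y * a) = a" for a using XY by (simp add: mult.assoc[symmetric])
  show m1: "moment \<phi> (g 1) n = 2 - Y ^ n" for n
  proof (induction n)
    case (Suc n)
    have "moment \<phi> (g 1) (Suc n) = (2 - Y ^ n) + (X ^ 1 - 1) * Y ^ Suc n * 1"
      using moment_neg_rec[of 1 n] Y_g[of 0] Suc.IH m0 by simp
    thus ?case by (simp add: algebra_simps XY')
  qed (use base[of 1] in simp)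
  show "moment \<phi> (g 2) n = 1 + (X + 1) * (1 - Y ^ n) + (1 - Y ^ n) * (1 - X * Y ^ n)"
  proof (induction n)
    case (Suc n)
    have "moment \<phi> (g 2) (Suc n) = (1 + (X + 1) * (1 - Y ^ n) + (1 - Y ^ n) * (1 - X * Y ^ n)) +
        (X ^ 2 - 1) * Y ^ Suc n * (2 - Y ^ n)"
      using moment_neg_rec[of 2 n] Y_g[of 1] Suc.IH m1 by (simp add: numeral_2_eq_2)
    thus ?case by (simp add: algebra_simps XY' power2_eq_square)
  qed (use base[of 2] in simp)
qed

section \<open>Moments belonging to the odd length\<close>

private abbreviation "\<omega> \<equiv> quotient_sum (odd_weight Y)"

text \<open>The recursions of the odd quotient sums depend on the parity of n - b; splitting the
  moment accordingly yields a first-order recursion for the pair of parts.\<close>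

private definition even_moment :: "nat \<Rightarrow> nat \<Rightarrow> 'a" where
  "even_moment k n = (\<Sum>b | b \<le> n \<and> even (n - b). \<omega> n b * (Y ^ (Suc b choose 2) * X ^ (k * b)))"

private definition odd_moment :: "nat \<Rightarrow> nat \<Rightarrow> 'a" where
  "odd_moment k n = (\<Sum>b | b \<le> n \<and> odd (n - b). \<omega> n b * (Y ^ (Suc b choose 2) * X ^ (k * b)))"

text \<open>The factor in \<open>odd_quotient_sum_odd\<close> depends on b + m + 1 = n + 1 only, so
  it leaves the sum over b.\<close>

private lemma odd_moment_Suc: "odd_moment k (Suc n) = (1 - Y ^ Suc n) * even_moment k n"
proof -
  have sets: "{b. b \<le> Suc n \<and> odd (Suc n - b)} = {b. b \<le> n \<and> even (n - b)}"
    by (auto simp: Suc_diff_le le_Suc_eq)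
  show ?thesis
    unfolding odd_moment_def even_moment_def sum_distrib_left sets
  proof (intro sum.cong refl)
    fix b assume "b \<in> {b. b \<le> n \<and> even (n - b)}"
    hence b: "b \<le> n" "even (n - b)" by blast+
    have "\<omega> (Suc n) b = (1 - Y ^ Suc n) * \<omega> n b"
      using odd_quotient_sum_odd[OF b(2), of Y b] b(1) by simp
    thus "\<omega> (Suc n) b * (Y ^ (Suc b choose 2) * X ^ (k * b)) =
        (1 - Y ^ Suc n) * (\<omega> n b * (Y ^ (Suc b choose 2) * X ^ (k * b)))"
      by (simp only: mult.assoc)
  qed
qed

private lemma even_moment_Suc: "even_moment k (Suc n) = odd_moment k n + X ^ k * Y ^ Suc n * even_moment k n"
proof -
  let ?h = "\<lambda>b. Y ^ (Suc b choose 2) * X ^ (k * b)"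
  let ?f = "\<lambda>b b'. if even (Suc n - b) then \<omega> n b' * (Y ^ (Suc n - b) * ?h b) else 0"
  have step: "(if even (Suc n - b) then \<omega> (Suc n) b * ?h b else 0) =
      (if odd (n - b) then \<omega> n b * ?h b else 0) + at_pred (?f b) b" if "b \<le> n" for b
  proof -
    define m where "m = n - b"
    have n: "n = b + m" using that by (simp add: m_def)
    show ?thesis
    proof (cases "odd m")
      case True
      have "at_pred (?f b) b = Y ^ Suc m * at_pred (\<lambda>b. \<omega> (b + Suc m) b) b * ?h b"
        using True by (cases b) (auto simp: n mult_ac)
      thus ?thesis
        using True odd_quotient_sum_even[OF True, of Y b] unfolding n
        by (simp add: distrib_right del: power_Suc)
    next
      case False
      have "at_pred (?f b) b = 0" using False by (cases b) (auto simp: n)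
      thus ?thesis using False by (simp add: n)
    qed
  qed
  have "even_moment k (Suc n) = (\<Sum>b\<le>Suc n. if even (Suc n - b) then \<omega> (Suc n) b * ?h b else 0)"
    unfolding even_moment_def by (intro sum.mono_neutral_cong_left) auto
  also have "\<dots> = (\<Sum>b\<le>n. if even (Suc n - b) then \<omega> (Suc n) b * ?h b else 0) + ?h (Suc n)"
    by (simp add: quotient_sum_self)
  also have "(\<Sum>b\<le>n. if even (Suc n - b) then \<omega> (Suc n) b * ?h b else 0) =
      (\<Sum>b\<le>n. if odd (n - b) then \<omega> n b * ?h b else 0) + (\<Sum>b\<le>n. at_pred (?f b) b)"
    unfolding sum.distrib[symmetric] by (intro sum.cong refl step) simp
  also have "(\<Sum>b\<le>n. if odd (n - b) then \<omega> n b * ?h b else 0) = odd_moment k n"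
    unfolding odd_moment_def by (intro sum.mono_neutral_cong_right) auto
  also have "odd_moment k n + (\<Sum>b\<le>n. at_pred (?f b) b) + ?h (Suc n) =
      odd_moment k n + (\<Sum>b\<le>n. ?f (Suc b) b)"
    using sum_at_pred[of ?f n] by (simp add: quotient_sum_self add.assoc)
  also have "(\<Sum>b\<le>n. ?f (Suc b) b) = X ^ k * Y ^ Suc n * even_moment k n"
  proof -
    have e: "Y ^ (n - b) * ?h (Suc b) = X ^ k * Y ^ Suc n * ?h b" if "b \<le> n" for b
    proof -
      \<comment> \<open>The binomial grows by b + 1, which offsets -b: the extra power of Y is free
        of b, and the recursion closes for each k separately.\<close>
      have "n - b + (Suc (Suc b) choose 2) = Suc n + (Suc b choose 2)"
        using that by (simp add: numeral_2_eq_2)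
      hence "Y ^ (n - b) * Y ^ (Suc (Suc b) choose 2) = Y ^ Suc n * Y ^ (Suc b choose 2)"
        by (simp only: power_add[symmetric])
      moreover have "X ^ (k * Suc b) = X ^ k * X ^ (k * b)" by (simp add: power_add)
      ultimately show ?thesis by (simp only: mult.assoc[symmetric]) (simp only: mult_ac)
    qed
    have "(\<Sum>b\<le>n. ?f (Suc b) b) =
        (\<Sum>b\<le>n. if even (n - b) then X ^ k * Y ^ Suc n * (\<omega> n b * ?h b) else 0)"
    proof (intro sum.cong refl)
      fix b assume "b \<in> {..n}"
      hence "b \<le> n" by simp
      show "?f (Suc b) b = (if even (n - b) then X ^ k * Y ^ Suc n * (\<omega> n b * ?h b) else 0)"
        unfolding diff_Suc_Suc e[OF \<open>b \<le> n\<close>] by (simp only: mult.left_commute)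
    qed
    also have "\<dots> = (\<Sum>b | b \<le> n \<and> even (n - b). X ^ k * Y ^ Suc n * (\<omega> n b * ?h b))"
      by (intro sum.mono_neutral_cong_right) auto
    finally show ?thesis by (simp only: even_moment_def sum_distrib_left)
  qed
  finally show ?thesis .
qed

private lemma moment_odd_split:
  "moment \<omega> (\<lambda>b. Y ^ (Suc b choose 2) * X ^ (k * b)) n = even_moment k n + odd_moment k n"
proof -
  have "{..n} = {b. b \<le> n \<and> even (n - b)} \<union> {b. b \<le> n \<and> odd (n - b)}" by auto
  moreover have "{b. b \<le> n \<and> even (n - b)} \<inter> {b. b \<le> n \<and> odd (n - b)} = {}" by auto
  ultimately show ?thesis
    unfolding moment_def even_moment_def odd_moment_def by (simp add: sum.union_disjoint)
qed

private lemma even_odd_moment_0: "even_moment k 0 = 1" "odd_moment k 0 = 0"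
proof -
  have "{b. b \<le> (0 :: nat) \<and> even (0 - b)} = {0}" by auto
  thus "even_moment k 0 = 1"
    unfolding even_moment_def by (simp add: quotient_sum_self numeral_2_eq_2)
  show "odd_moment k 0 = 0" by (simp add: odd_moment_def)
qed

lemma moment_odd:
  "moment \<omega> (\<lambda>b. Y ^ (Suc b choose 2) * X ^ (0 * b)) n = 1"
  "moment \<omega> (\<lambda>b. Y ^ (Suc b choose 2) * X ^ (1 * b)) n = 2 - Y ^ n"
  "moment \<omega> (\<lambda>b. Y ^ (Suc b choose 2) * X ^ (2 * b)) n =
    2 - Y ^ n + X * (1 - Y ^ n) * (2 - X * Y ^ n)"
proof -
  have XY': "X * (Y * a) = a" for a using XY by (simp add: mult.assoc[symmetric])
  have "even_moment 0 n + odd_moment 0 n = 1"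
    by (induction n)
       (simp_all add: even_odd_moment_0 even_moment_Suc odd_moment_Suc algebra_simps)
  thus "moment \<omega> (\<lambda>b. Y ^ (Suc b choose 2) * X ^ (0 * b)) n = 1"
    by (simp only: moment_odd_split)
  have "even_moment 1 n = 1 \<and> odd_moment 1 n = 1 - Y ^ n"
    by (induction n)
       (simp_all add: even_odd_moment_0 even_moment_Suc odd_moment_Suc algebra_simps XY')
  thus "moment \<omega> (\<lambda>b. Y ^ (Suc b choose 2) * X ^ (1 * b)) n = 2 - Y ^ n"
    by (simp only: moment_odd_split) simp
  \<comment> \<open>Only the sum of both parts is wanted, but the induction needs each of
    them.\<close>
  have "even_moment 2 n = X + 1 - X * Y ^ n \<and> odd_moment 2 n = (1 - Y ^ n) * (X + 1 - X * (X * Y ^ n))"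
  proof (induction n)
    case (Suc n)
    show ?case
      unfolding even_moment_Suc odd_moment_Suc conjunct1[OF Suc.IH] conjunct2[OF Suc.IH]
      by (simp add: algebra_simps XY' power2_eq_square)
  qed (simp add: even_odd_moment_0)
  thus "moment \<omega> (\<lambda>b. Y ^ (Suc b choose 2) * X ^ (2 * b)) n =
      2 - Y ^ n + X * (1 - Y ^ n) * (2 - X * Y ^ n)"
    by (simp only: moment_odd_split) (simp add: algebra_simps)
qed

lemma neg_descent_sum:
  defines "x \<equiv> \<lambda>c i. c * X ^ (2 * i) * Y ^ (i ^ 2)"
  shows "(1 - c) ^ 2 * (1 - c * X) * descent_sum (neg_weight Y) (x c) n =
    (\<Prod>i\<le>n. 1 - x c i) * ((1 - c * Y ^ n) * (1 - c * X * Y ^ n) + c * (1 - Y ^ n) * (1 - X * Y ^ n))"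
proof (rule descent_sum_closed[where P =
    "\<lambda>n. (1 - c * Y ^ n) * (1 - c * X * Y ^ n) + c * (1 - Y ^ n) * (1 - X * Y ^ n)"])
  fix n b :: nat and u
  assume "b < n" "u \<in> maximal_quotient n b"
  thus "(\<Sum>v\<in>hyperoctahedral b. neg_weight Y n (u \<circ> v) * (\<Prod>i\<in>Des b v. x c i)) =
      neg_weight Y n u * descent_sum (neg_weight Y) (x c) b"
    unfolding descent_sum_def sum_distrib_left
    by (intro sum.cong refl) (simp add: neg_weight_comp mult.assoc)
next
  fix n
  let ?P = "\<lambda>n. (1 - c * Y ^ n) * (1 - c * X * Y ^ n) + c * (1 - Y ^ n) * (1 - X * Y ^ n)"
  have P: "x c b * ?P b = c * (1 + c) * g 2 b - 2 * c * c * (1 + X) * g 1 b + c * (c + c * c) * X * g 0 b"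
    for b
  proof -
    have "X ^ (2 * b) = X ^ b * X ^ b" by (simp add: mult_2 power_add)
    thus ?thesis
      unfolding x_def using neg_numerator_expand[of "X ^ b" "Y ^ b" c "Y ^ b\<^sup>2" X] by simp
  qed
  have "x c n * ?P n + (\<Sum>b<n. \<phi> n b * x c b * ?P b) = (\<Sum>b\<le>n. \<phi> n b * (x c b * ?P b))"
    by (simp add: lessThan_Suc_atMost[symmetric] quotient_sum_self mult.assoc)
  also have "\<dots> = c * (1 + c) * moment \<phi> (g 2) n - 2 * c * c * (1 + X) * moment \<phi> (g 1) n +
      c * (c + c * c) * X * moment \<phi> (g 0) n"
    unfolding moment_def sum_distrib_left sum_subtractf[symmetric] sum.distrib[symmetric] P
    by (intro sum.cong refl) (simp add: algebra_simps)
  \<comment> \<open>The moments are polynomials in \<open>Y ^ n\<close>, and all powers of it match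
    those of \<open>P\<close>; what is left over is free of n, as \<open>descent_sum_closed\<close>
    demands of \<open>K\<close>.\<close>
  also have "\<dots> = ?P n - (1 - c) ^ 2 * (1 - c * X)"
    unfolding moment_neg by (simp add: algebra_simps power2_eq_square)
  finally show "?P n = (1 - c) ^ 2 * (1 - c * X) + x c n * ?P n + (\<Sum>b<n. \<phi> n b * x c b * ?P b)"
    by (simp add: algebra_simps)
qed simp

end

text \<open>Characteristic 0 enters through the involution, which only shows that twice the
  cancelling sum is zero.\<close>

lemma odd_descent_sum:
  fixes X Y c :: "'a :: field_char_0"
  assumes XY: "X * Y = 1"
  defines "x \<equiv> \<lambda>i. c * X ^ (2 * i) * Y ^ (Suc i choose 2)"
  shows "(1 - c) * (1 - c * X) ^ 2 * descent_sum (odd_weight Y) x n =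
    (\<Prod>i\<le>n. 1 - x i) * ((1 - c * Y ^ n) * (1 - c * X ^ 2 * Y ^ n) + c * (1 - X * Y ^ n) ^ 2)"
proof (rule descent_sum_closed[where P =
    "\<lambda>n. (1 - c * Y ^ n) * (1 - c * X ^ 2 * Y ^ n) + c * (1 - X * Y ^ n) ^ 2"])
  fix n b :: nat and u
  assume "b < n" "u \<in> maximal_quotient n b"
  thus "(\<Sum>v\<in>hyperoctahedral b. odd_weight Y n (u \<circ> v) * (\<Prod>i\<in>Des b v. x i)) =
      odd_weight Y n u * descent_sum (odd_weight Y) x b"
    unfolding descent_sum_def by (intro odd_weight_comp_sum) auto
next
  fix n
  let ?\<omega> = "quotient_sum (odd_weight Y)"
  let ?g = "\<lambda>k b. Y ^ (Suc b choose 2) * X ^ (k * b)"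
  let ?P = "\<lambda>n. (1 - c * Y ^ n) * (1 - c * X ^ 2 * Y ^ n) + c * (1 - X * Y ^ n) ^ 2"
  have P: "x b * ?P b = c * (1 + c) * ?g 2 b - c * c * (1 + X) ^ 2 * ?g 1 b + c * (c + c * c) * X ^ 2 * ?g 0 b"
    for b
  proof -
    have "X ^ (2 * b) = X ^ b * X ^ b" by (simp add: mult_2 power_add)
    moreover have "X ^ b * Y ^ b = 1" using XY by (simp flip: power_mult_distrib)
    ultimately show ?thesis
      unfolding x_def using odd_numerator_expand[of "X ^ b" "Y ^ b" c "Y ^ (Suc b choose 2)" X]
      by simp
  qed
  have "x n * ?P n + (\<Sum>b<n. ?\<omega> n b * x b * ?P b) = (\<Sum>b\<le>n. ?\<omega> n b * (x b * ?P b))"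
    by (simp add: lessThan_Suc_atMost[symmetric] quotient_sum_self mult.assoc)
  also have "\<dots> = c * (1 + c) * moment ?\<omega> (?g 2) n - c * c * (1 + X) ^ 2 * moment ?\<omega> (?g 1) n +
      c * (c + c * c) * X ^ 2 * moment ?\<omega> (?g 0) n"
    unfolding moment_def sum_distrib_left sum_subtractf[symmetric] sum.distrib[symmetric] P
    by (intro sum.cong refl) (simp add: algebra_simps)
  also have "\<dots> = ?P n - (1 - c) * (1 - c * X) ^ 2"
    unfolding moment_odd[OF XY] by (simp add: algebra_simps power2_eq_square)
  finally show "?P n = (1 - c) * (1 - c * X) ^ 2 + x n * ?P n + (\<Sum>b<n. ?\<omega> n b * x b * ?P b)"
    by (simp add: algebra_simps)
qed simp

section \<open>The two identities\<close>

text \<open>An odd i + j is never 0, so exactly one member of each mirror couple satisfies i + j >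
  0, that is, |i| < j.\<close>

lemma odd_length_eq:
  assumes w: "w \<in> hyperoctahedral n"
  shows "odd_length n w = parity_inversions n w"
proof -
  let ?A = "inversions (\<lambda>i j. odd (i + j)) n w" and ?r = "\<lambda>(i :: int, j :: int). (- j, - i)"
  have mod: "i mod 2 \<noteq> j mod 2 \<longleftrightarrow> odd (i + j)" for i j :: int by presburger
  have mem: "(i, j) \<in> odd_inversions n w \<longleftrightarrow> (i, j) \<in> ?A \<or> (- j, - i) \<in> ?A" for i j
  proof -
    have "i + j \<noteq> 0" if "odd (i + j)" using that by presburger
    then consider "i + j > 0" | "i + j < 0" | "even (i + j)" by linarith
    thus ?thesis
      by cases (auto simp: odd_inversions_def inversions_def mod hyp_minus[OF w])
  qed
  have "odd_inversions n w = ?A \<union> ?r ` ?A"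
  proof (intro set_eqI)
    fix x :: "int \<times> int"
    obtain i j where x: "x = (i, j)" by (cases x)
    have "(- j, - i) \<in> ?A \<longleftrightarrow> (i, j) \<in> ?r ` ?A"
    proof
      assume "(- j, - i) \<in> ?A"
      thus "(i, j) \<in> ?r ` ?A" by (rule image_eqI[rotated]) simp
    qed auto
    thus "x \<in> odd_inversions n w \<longleftrightarrow> x \<in> ?A \<union> ?r ` ?A"
      unfolding x mem by blast
  qed
  moreover have "?A \<inter> ?r ` ?A = {}" by (auto simp: inversions_def)
  moreover have "card (?r ` ?A) = card ?A" by (rule card_image) (auto simp: inj_on_def)
  ultimately have "card (odd_inversions n w) = 2 * card ?A"
    by (simp add: card_Un_disjoint)
  thus ?thesis by (simp add: odd_length_def parity_inversions_def)
qed

lemma X_nonzero [simp]: "X \<noteq> 0"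
  by (simp add: X_def)

text \<open>Putting Z = 0 would give 0 = 1. This makes the factors 1 - c and 1 - c X of the constant
  \<open>K\<close> cancellable.\<close>

lemma power_X_Z_neq_1: "X ^ k * Z \<noteq> 1"
proof
  assume "X ^ k * Z = 1"
  moreover have "X ^ k = to_fract ([:[:0, 1:]:] ^ k)"
    by (induction k) (simp_all only: power_0 power_Suc to_fract_1 to_fract_mult X_def)
  ultimately have "to_fract ([:[:0, 1:]:] ^ k * [:0, 1:]) = to_fract (1 :: rat poly poly)"
    by (simp only: Z_def to_fract_mult to_fract_1)
  hence "[:[:0, 1:]:] ^ k * [:0, 1:] = (1 :: rat poly poly)"
    by (simp only: to_fract_eq_iff)
  hence "poly ([:[:0, 1:]:] ^ k * [:0, 1:]) 0 = poly (1 :: rat poly poly) 0"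
    by (simp only:)
  thus False by simp
qed

lemma prod_power_int:
  fixes x :: "'a :: field"
  assumes "x \<noteq> 0"
  shows "(\<Prod>i\<in>A. x powi f i) = x powi (\<Sum>i\<in>A. f i)"
  using assms by (induction A rule: infinite_finite_induct) (simp_all add: power_int_add)

lemma descent_monomial:
  "X powi (- int l + (\<Sum>i\<in>Des n w. f i)) * Z ^ des n w =
    inverse X ^ l * (\<Prod>i\<in>Des n w. X powi f i * Z)"
proof -
  have "X powi (- int l + (\<Sum>i\<in>Des n w. f i)) = inverse X ^ l * (\<Prod>i\<in>Des n w. X powi f i)"
    by (subst power_int_add) (simp_all add: prod_power_int power_int_minus power_inverse)
  thus ?thesis by (simp add: prod.distrib des_def)
qed

lemma prod_atMost_split:
  fixes f :: "nat \<Rightarrow> 'a :: comm_monoid_mult"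
  assumes "2 \<le> n"
  shows "(\<Prod>i\<le>n. f i) = f 0 * f 1 * f 2 * (\<Prod>i=3..n. f i)"
proof -
  have "{..n} = {0, 1, 2} \<union> {3..n}" using assms by auto
  thus ?thesis by (simp add: prod.union_disjoint mult.assoc)
qed

lemma int_choose_two: "2 * int (n choose 2) = int n * (int n - 1)"
  by (induction n) (simp_all add: numeral_2_eq_2 algebra_simps)

lemma int_Suc_choose_two: "2 * int ((n + 1) choose 2) = int n * (int n + 1)"
  using int_choose_two[of "n + 1"] by (simp add: algebra_simps)

lemma neg_sum_formula:
  assumes n: "2 \<le> n"
  shows "(\<Sum>w\<in>hyperoctahedral n.
      (- 1) ^ neg n w * X powi (- (int (cox_length n w) - sigma n w - 2 * maj n w)) * Z ^ des n w) =
    (\<Prod>i=3..n. 1 - X powi (int n ^ 2 - int i ^ 2 + 2 * int i) * Z)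
      * ((1 - X powi (2 * int (n choose 2)) * Z) * (1 - X powi (2 * int (n choose 2) + 1) * Z)
         + X powi (int n ^ 2) * Z * (1 - X powi (- int n)) * (1 - X powi (- int n + 1)))"
    (is "?S = ?P * ?F")
proof -
  define Y where "Y = inverse X"
  define c where "c = X ^ (n ^ 2) * Z"
  define x where "x = (\<lambda>i. c * X ^ (2 * i) * Y ^ (i ^ 2))"
  have XY: "X * Y = 1" by (simp add: Y_def)
  have Y_pow: "Y ^ k = X powi (- int k)" for k
    by (simp add: Y_def power_int_minus power_inverse)
  have x_eq: "x i = X powi (int n ^ 2 - int i ^ 2 + 2 * int i) * Z" for i
    unfolding x_def c_def Y_pow by (simp add: power_int_add power_int_diff power_int_minus
      divide_simps flip: power_int_of_nat)
  have "?S = descent_sum (neg_weight Y) x n"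
    unfolding descent_sum_def
  proof (intro sum.cong refl)
    fix w assume w: "w \<in> hyperoctahedral n"
    have "- (int (cox_length n w) - sigma n w - 2 * maj n w) =
        - int (signed_length n w) + (\<Sum>i\<in>Des n w. int n ^ 2 - int i ^ 2 + 2 * int i)"
      by (simp add: cox_length_eq[OF w] sigma_def maj_def sum.distrib sum_distrib_left)
    thus "(- 1) ^ neg n w * X powi (- (int (cox_length n w) - sigma n w - 2 * maj n w)) * Z ^ des n w =
        neg_weight Y n w * (\<Prod>i\<in>Des n w. x i)"
      by (simp only: mult.assoc descent_monomial neg_weight_def x_eq Y_def)
  qed
  moreover have "(1 - c) ^ 2 * (1 - c * X) * descent_sum (neg_weight Y) x n =
      (1 - c) ^ 2 * (1 - c * X) * (?P * ?F)"
  proof -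
    \<comment> \<open>The exponent 2 i - i^2 is 0, 1, 0 at i = 0, 1, 2, which produces the constant
      of \<open>neg_descent_sum\<close>.\<close>
    have x012: "x 0 = c" "x 1 = c * X" "x 2 = c"
    proof -
      have "X ^ 2 * Y = X * (X * Y)" "X ^ 4 * Y ^ 4 = (X * Y) ^ 4"
        by (simp_all only: power2_eq_square power_mult_distrib mult.assoc)
      thus "x 0 = c" "x 1 = c * X" "x 2 = c" by (simp_all add: x_def mult.assoc XY)
    qed
    have e: "int n ^ 2 + - int n = 2 * int (n choose 2)"
      unfolding int_choose_two by (simp add: algebra_simps power2_eq_square)
    have c: "c = X powi (int n ^ 2) * Z"
      unfolding c_def by (simp flip: power_int_of_nat)
    have cY: "c * Y ^ n = X powi (2 * int (n choose 2)) * Z"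
      unfolding c Y_pow e[symmetric] by (subst power_int_add) (simp_all add: mult_ac)
    have XYn: "X * Y ^ n = X powi (- int n + 1)"
      unfolding Y_pow by (subst power_int_add) simp_all
    have "c * X * Y ^ n = X powi (2 * int (n choose 2) + 1) * Z"
      using cY by (simp add: power_int_add mult_ac)
    hence F: "(1 - c * Y ^ n) * (1 - c * X * Y ^ n) + c * (1 - Y ^ n) * (1 - X * Y ^ n) = ?F"
      by (simp only: cY XYn) (simp only: c Y_pow)
    have "(1 - c) ^ 2 * (1 - c * X) * descent_sum (neg_weight Y) x n = (\<Prod>i\<le>n. 1 - x i) * ?F"
      unfolding F[symmetric] x_def by (rule neg_descent_sum[OF XY])
    also have "(\<Prod>i\<le>n. 1 - x i) = (1 - c) ^ 2 * (1 - c * X) * ?P"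
      unfolding prod_atMost_split[OF n] x012 by (simp only: x_eq power2_eq_square mult_ac)
    finally show ?thesis by (simp only: mult.assoc)
  qed
  moreover have "c \<noteq> 1" "c * X \<noteq> 1"
    using power_X_Z_neq_1[of "n ^ 2"] power_X_Z_neq_1[of "Suc (n ^ 2)"]
    by (simp_all add: c_def mult_ac)
  ultimately show ?thesis by simp
qed

lemma odd_sum_formula:
  assumes n: "2 \<le> n"
  shows "(\<Sum>w\<in>hyperoctahedral n.
      (- 1) ^ cox_length n w
        * X powi ((- (2 * int (odd_length n w) - sigma n w + 3 * rmaj n w - 4 * int n * int (des n w))) div 2)
        * Z ^ des n w) =
    (\<Prod>i=3..n. 1 - X powi (int ((n + 1) choose 2) - int ((i + 1) choose 2) + 2 * int i) * Z)
      * ((1 - X powi (int (n choose 2)) * Z) * (1 - X powi (int (n choose 2) + 2) * Z)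
         + X powi (int ((n + 1) choose 2)) * Z * (1 - X powi (- int n + 1)) ^ 2)"
    (is "?S = ?P * ?F")
proof -
  define Y where "Y = inverse X"
  define c where "c = X ^ ((n + 1) choose 2) * Z"
  define x where "x = (\<lambda>i. c * X ^ (2 * i) * Y ^ (Suc i choose 2))"
  have XY: "X * Y = 1" by (simp add: Y_def)
  have Y_pow: "Y ^ k = X powi (- int k)" for k
    by (simp add: Y_def power_int_minus power_inverse)
  have x_eq: "x i = X powi (int ((n + 1) choose 2) - int ((i + 1) choose 2) + 2 * int i) * Z" for i
    unfolding x_def c_def Y_pow by (simp add: power_int_add power_int_diff power_int_minus
      divide_simps flip: power_int_of_nat)
  have "?S = descent_sum (odd_weight Y) x n"
    unfolding descent_sum_def
  proof (intro sum.cong refl)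
    fix w assume w: "w \<in> hyperoctahedral n"
    let ?f = "\<lambda>i. int ((n + 1) choose 2) - int ((i + 1) choose 2) + 2 * int i"
    have "- (2 * int (odd_length n w) - sigma n w + 3 * rmaj n w - 4 * int n * int (des n w)) =
        - (2 * int (parity_inversions n w)) +
        (\<Sum>i\<in>Des n w. (int n ^ 2 - int i ^ 2) - 3 * (int n - int i) + 4 * int n)"
      by (simp add: odd_length_eq[OF w] sigma_def rmaj_def des_def sum.distrib sum_subtractf
          sum_distrib_left algebra_simps)
    \<comment> \<open>Each descent contributes the even number n (n + 1) - i (i + 1) + 4 i, so the
      halving is exact descent by descent.\<close>
    also have "(\<Sum>i\<in>Des n w. (int n ^ 2 - int i ^ 2) - 3 * (int n - int i) + 4 * int n) =
        (\<Sum>i\<in>Des n w. 2 * ?f i)"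
    proof (intro sum.cong refl)
      fix i
      have "2 * ?f i = int n * (int n + 1) - int i * (int i + 1) + 4 * int i"
        unfolding int_Suc_choose_two[symmetric] by (simp add: algebra_simps)
      thus "(int n ^ 2 - int i ^ 2) - 3 * (int n - int i) + 4 * int n = 2 * ?f i"
        by (simp add: algebra_simps power2_eq_square)
    qed
    also have "- (2 * int (parity_inversions n w)) + (\<Sum>i\<in>Des n w. 2 * ?f i) =
        2 * (- int (parity_inversions n w) + (\<Sum>i\<in>Des n w. ?f i))"
      by (simp only: sum_distrib_left distrib_left mult_minus_right)
    finally have "- (2 * int (odd_length n w) - sigma n w + 3 * rmaj n w - 4 * int n * int (des n w)) div 2 =
        - int (parity_inversions n w) + (\<Sum>i\<in>Des n w. ?f i)"
      by simp
    thus "(- 1) ^ cox_length n w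
        * X powi ((- (2 * int (odd_length n w) - sigma n w + 3 * rmaj n w - 4 * int n * int (des n w))) div 2)
        * Z ^ des n w = odd_weight Y n w * (\<Prod>i\<in>Des n w. x i)"
      by (simp only: mult.assoc descent_monomial odd_weight_def x_eq Y_def cox_length_eq[OF w])
  qed
  moreover have "(1 - c) * (1 - c * X) ^ 2 * descent_sum (odd_weight Y) x n =
      (1 - c) * (1 - c * X) ^ 2 * (?P * ?F)"
  proof -
    \<comment> \<open>The exponent 2 i - i (i + 1) / 2 is 0, 1, 1 at i = 0, 1, 2.\<close>
    have x012: "x 0 = c" "x 1 = c * X" "x 2 = c * X"
    proof -
      have "X ^ 2 * Y = X * (X * Y)" "X ^ 4 * Y ^ 3 = X * (X * Y) ^ 3"
        by (simp_all add: power2_eq_square power_mult_distrib eval_nat_numeral)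
      moreover have "Suc 0 choose 2 = 0" "Suc 1 choose 2 = 1" "Suc 2 choose 2 = 3"
        by (simp_all add: eval_nat_numeral)
      ultimately show "x 0 = c" "x 1 = c * X" "x 2 = c * X"
        by (simp_all add: x_def mult.assoc XY binomial_eq_0)
    qed
    have e: "int ((n + 1) choose 2) + - int n = int (n choose 2)"
      by (simp add: numeral_2_eq_2)
    have c: "c = X powi (int ((n + 1) choose 2)) * Z"
      unfolding c_def by (simp flip: power_int_of_nat)
    have cY: "c * Y ^ n = X powi (int (n choose 2)) * Z"
      unfolding c Y_pow e[symmetric] by (subst power_int_add) (simp_all add: mult_ac)
    have XYn: "X * Y ^ n = X powi (- int n + 1)"
      unfolding Y_pow by (subst power_int_add) simp_all
    have "c * X ^ 2 * Y ^ n = X powi (int (n choose 2) + 2) * Z"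
      using cY by (simp add: power_int_add mult_ac)
    hence F: "(1 - c * Y ^ n) * (1 - c * X ^ 2 * Y ^ n) + c * (1 - X * Y ^ n) ^ 2 = ?F"
      by (simp only: cY XYn) (simp only: c)
    have "(1 - c) * (1 - c * X) ^ 2 * descent_sum (odd_weight Y) x n = (\<Prod>i\<le>n. 1 - x i) * ?F"
      unfolding F[symmetric] x_def by (rule odd_descent_sum[OF XY])
    also have "(\<Prod>i\<le>n. 1 - x i) = (1 - c) * (1 - c * X) ^ 2 * ?P"
      unfolding prod_atMost_split[OF n] x012 by (simp only: x_eq power2_eq_square mult_ac)
    finally show ?thesis by (simp only: mult.assoc)
  qed
  moreover have "c \<noteq> 1" "c * X \<noteq> 1"
    using power_X_Z_neq_1[of "(n + 1) choose 2"] power_X_Z_neq_1[of "Suc ((n + 1) choose 2)"]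
    by (simp_all add: c_def mult_ac)
  ultimately show ?thesis by simp
qed

section \<open>Polynomiality\<close>

lemma polys_closed:
  shows polys_1: "1 \<in> polys" and polys_X: "X \<in> polys" and polys_Z: "Z \<in> polys"
    and polys_add: "p \<in> polys \<Longrightarrow> q \<in> polys \<Longrightarrow> p + q \<in> polys"
    and polys_diff: "p \<in> polys \<Longrightarrow> q \<in> polys \<Longrightarrow> p - q \<in> polys"
    and polys_mult: "p \<in> polys \<Longrightarrow> q \<in> polys \<Longrightarrow> p * q \<in> polys"
  unfolding polys_def X_def Z_def image_iff
  by (blast intro: to_fract_1[symmetric] to_fract_add[symmetric] to_fract_diff[symmetric]
      to_fract_mult[symmetric])+

lemma polys_power: "p \<in> polys \<Longrightarrow> p ^ k \<in> polys"
  by (induction k) (auto intro: polys_1 polys_mult)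

lemma polys_prod: "(\<And>i. i \<in> A \<Longrightarrow> f i \<in> polys) \<Longrightarrow> prod f A \<in> polys"
  by (induction A rule: infinite_finite_induct) (auto intro: polys_1 polys_mult)

lemma polys_power_int_X: "0 \<le> k \<Longrightarrow> X powi k \<in> polys"
  by (simp add: power_int_def polys_power polys_X)

lemma one_minus_X_powi_polys: "0 \<le> k \<Longrightarrow> 1 - X powi k * Z \<in> polys"
  by (intro polys_1 polys_diff polys_mult polys_power_int_X polys_Z)

theorem proposition5p6:
  fixes n :: nat
  assumes "n \<ge> 2"
  shows
    "(let S = (\<Sum>w\<in>hyperoctahedral n.
          (- 1) ^ neg n w
            * X powi (- (int (cox_length n w) - sigma n w - 2 * maj n w))
            * Z ^ des n w)
      in S \<in> polys \<and>
         S = (\<Prod>i=3..n. 1 - X powi (int n ^ 2 - int i ^ 2 + 2 * int i) * Z)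
           * ((1 - X powi (2 * int (n choose 2)) * Z) * (1 - X powi (2 * int (n choose 2) + 1) * Z)
              + X powi (int n ^ 2) * Z * (1 - X powi (- int n)) * (1 - X powi (- int n + 1))))
   \<and> (let T = (\<Sum>w\<in>hyperoctahedral n.
          (- 1) ^ cox_length n w
            * X powi ((- (2 * int (odd_length n w) - sigma n w + 3 * rmaj n w
                          - 4 * int n * int (des n w))) div 2)
            * Z ^ des n w)
      in T \<in> polys \<and>
         T = (\<Prod>i=3..n. 1 - X powi (int ((n + 1) choose 2) - int ((i + 1) choose 2) + 2 * int i) * Z)
           * ((1 - X powi (int (n choose 2)) * Z) * (1 - X powi (int (n choose 2) + 2) * Z)
              + X powi (int ((n + 1) choose 2)) * Z * (1 - X powi (- int n + 1)) ^ 2))"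
proof -
  have n1: "0 \<le> int n - 1" using assms by simp
  \<comment> \<open>Replacing 1 - X^(-b) by X^b - 1 costs a factor X^(-b); the leading power of X
    has to pay for all such factors. In the first identity (n - 1)^2 remains of n^2.\<close>
  have mul: "X powi a * (1 - X powi (- b)) = X powi (a - b) * (X powi b - 1)" for a b
    by (simp add: power_int_diff power_int_minus field_simps)
  have mul2: "X powi a * Z * (1 - X powi (- b)) * (1 - X powi (- d)) =
      X powi (a - b - d) * Z * (X powi b - 1) * (X powi d - 1)" for a b d
  proof -
    have "X powi a * Z * (1 - X powi (- b)) * (1 - X powi (- d)) =
        X powi a * (1 - X powi (- b)) * (1 - X powi (- d)) * Z" by (simp only: mult_ac)
    also have "\<dots> = X powi (a - b) * (1 - X powi (- d)) * (X powi b - 1) * Z"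
      unfolding mul[of a b] by (simp only: mult_ac)
    also have "\<dots> = X powi (a - b - d) * Z * (X powi b - 1) * (X powi d - 1)"
      unfolding mul[of "a - b" d] by (simp only: mult_ac)
    finally show ?thesis .
  qed
  have e1: "X powi (int n ^ 2) * Z * (1 - X powi (- int n)) * (1 - X powi (- int n + 1)) =
      X powi (int n ^ 2 - int n - (int n - 1)) * Z * (X powi int n - 1) * (X powi (int n - 1) - 1)"
    using mul2[of "int n ^ 2" "int n" "int n - 1"] by simp
  have e2: "int n ^ 2 - int n - (int n - 1) = (int n - 1) ^ 2"
    by (simp add: power2_eq_square algebra_simps)
  have neg: "X powi (int n ^ 2) * Z * (1 - X powi (- int n)) * (1 - X powi (- int n + 1)) \<in> polys"
    unfolding e1 e2
    by (intro polys_mult polys_diff polys_1 polys_Z polys_power_int_X n1 zero_le_power2 of_nat_0_le_iff)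
  let ?t = "int ((n + 1) choose 2)"
  have e3: "X powi ?t * Z * (1 - X powi (- int n + 1)) ^ 2 =
      X powi (?t - (int n - 1) - (int n - 1)) * Z * (X powi (int n - 1) - 1) ^ 2"
    using mul2[of ?t "int n - 1" "int n - 1"] by (simp add: power2_eq_square mult.assoc)
  \<comment> \<open>Doubling clears the binomial; the remaining exponent in the second identity is
    then nonnegative because n is at least 2.\<close>
  have twice: "2 * (?t - (int n - 1) - (int n - 1)) = (int n - 1) * (int n - 2) + 2"
    using int_Suc_choose_two[of n] by (simp add: algebra_simps)
  have t: "0 \<le> ?t - (int n - 1) - (int n - 1)"
  proof -
    have "0 \<le> (int n - 1) * (int n - 2)" using assms by (intro mult_nonneg_nonneg) auto
    hence "0 \<le> 2 * (?t - (int n - 1) - (int n - 1))" unfolding twice by simp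
    thus ?thesis by (simp only: zero_le_mult_iff) simp
  qed
  have odd: "X powi ?t * Z * (1 - X powi (- int n + 1)) ^ 2 \<in> polys"
    unfolding e3
    by (intro polys_mult polys_power polys_diff polys_1 polys_Z polys_power_int_X n1 t)
  have "0 \<le> int n ^ 2 - int i ^ 2 + 2 * int i" if "i \<in> {3..n}" for i
    using that power_mono[of "int i" "int n" 2] by simp
  hence 1: "(\<Prod>i=3..n. 1 - X powi (int n ^ 2 - int i ^ 2 + 2 * int i) * Z) \<in> polys"
    by (intro polys_prod one_minus_X_powi_polys)
  have "0 \<le> int ((n + 1) choose 2) - int ((i + 1) choose 2) + 2 * int i" if "i \<in> {3..n}" for i
  proof -
    have "int i * (int i + 1) \<le> int n * (int n + 1)" using that by (intro mult_mono) auto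
    thus ?thesis unfolding int_Suc_choose_two[symmetric] by simp
  qed
  hence 2: "(\<Prod>i=3..n. 1 - X powi (int ((n + 1) choose 2) - int ((i + 1) choose 2) + 2 * int i) * Z) \<in> polys"
    by (intro polys_prod one_minus_X_powi_polys)
  show ?thesis
    unfolding Let_def neg_sum_formula[OF assms] odd_sum_formula[OF assms]
    by (intro conjI refl polys_mult[OF 1] polys_mult[OF 2] polys_add[OF _ neg] polys_add[OF _ odd]
        polys_mult one_minus_X_powi_polys) simp_all
qed

end
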